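(* Let $\alpha>0$, let $\{t_n\}_{n\in\mathbb N}$ be a sequence in $\mathbb R^+$, and let $X_\alpha$ be an $\alpha$-permanental process indexed by $\{0\}\cup\{t_n:n\in\mathbb N\}$ with kernel $u$ and sigma function $\sigma$. Assume that $\beta^2:=\lim_{n\to\infty}\sigma^2(t_n,0)\log n$ exists (in $[0,\infty]$, with $\beta\ge0$). If $\beta=\infty$, then $$\limsup_{n\to\infty}\frac{X_\alpha(t_n)}{\sigma^2(t_n,0)\log n}\le1\qquad a.s.$$ If $0<\beta<\infty$, then $$\limsup_{n\to\infty}|X_\alpha(t_n)-X_\alpha(0)|\le\beta^2+2\beta X_\alpha^{1/2}(0)\qquad a.s.$$ If $\beta=0$, then $$\limsup_{n\to\infty}\frac{|X_\alpha(t_n)-X_\alpha(0)|}{\sigma(t_n,0)(\log n)^{1/2}}\le2X_\alpha^{1/2}(0)\qquad a.s.$$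
   Context: For $\alpha>0$, a random vector $(X_1,\dots,X_n)$ with nonnegative components is $\alpha$-permanental with kernel $U$ (a real $n\times n$ matrix) if $E\big(e^{-\sum_{i=1}^n s_iX_i}\big)=|I+US|^{-\alpha}$ for every diagonal matrix $S$ with positive diagonal entries $s_1,\dots,s_n$, where $|\cdot|$ denotes the determinant. A stochastic process $\{X_\alpha(t),t\in\mathcal T\}$ is an $\alpha$-permanental process with kernel $\{u(s,t),s,t\in\mathcal T\}$ if for all $r_1,\dots,r_n\in\mathcal T$ the vector $(X_\alpha(r_1),\dots,X_\alpha(r_n))$ is $\alpha$-permanental with kernel $\{u(r_i,r_j)\}_{i,j=1}^n$. Its sigma function is $\sigma(s,t)=\big(u(s,s)+u(t,t)-2(u(s,t)u(t,s))^{1/2}\big)^{1/2}$ (all quantities under the square roots are known to be nonnegative). The quotient $0/0$ is taken to be $0$ (if $\sigma(s,t)=0$ then $X_\alpha(s)=X_\alpha(t)$ a.s.). *)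

theory Defs
  imports "Jordan_Normal_Form.Determinant" "HOL-Probability.Probability"
begin

text \<open>
  The entries of a random vector are \<open>X 0, \<dots>, X (n - 1)\<close>; nonnegativity is required almost surely.
  The equation for the Laplace transform never uses \<open>powr\<close> outside its proper domain: its left-hand
  side is positive, so the determinant does not vanish, and it tends to 1 as \<open>s\<close> tends to 0, so it
  is positive for all positive \<open>s\<close> by connectedness.
\<close>

definition permanental_vector ::
    "'w measure \<Rightarrow> real \<Rightarrow> nat \<Rightarrow> real mat \<Rightarrow> (nat \<Rightarrow> 'w \<Rightarrow> real) \<Rightarrow> bool" where
  "permanental_vector M \<alpha> n U X \<longleftrightarrow>
     U \<in> carrier_mat n n \<and>
     (\<forall>i<n. X i \<in> borel_measurable M \<and> (AE \<omega> in M. 0 \<le> X i \<omega>)) \<and>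
     (\<forall>s :: nat \<Rightarrow> real. (\<forall>i<n. 0 < s i) \<longrightarrow>
        integral\<^sup>L M (\<lambda>\<omega>. exp (- (\<Sum>i<n. s i * X i \<omega>))) =
          Determinant.det (1\<^sub>m n + U * mat_diag n s) powr (- \<alpha>))"

definition permanental_process ::
    "'w measure \<Rightarrow> real \<Rightarrow> 'i set \<Rightarrow> ('i \<Rightarrow> 'i \<Rightarrow> real) \<Rightarrow> ('i \<Rightarrow> 'w \<Rightarrow> real) \<Rightarrow> bool" where
  "permanental_process M \<alpha> T u X \<longleftrightarrow>
     (\<forall>n (r :: nat \<Rightarrow> 'i). (\<forall>i<n. r i \<in> T) \<longrightarrow>
        permanental_vector M \<alpha> n (Matrix.mat n n (\<lambda>(i, j). u (r i) (r j))) (\<lambda>i. X (r i)))"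

definition sigma_fun :: "('i \<Rightarrow> 'i \<Rightarrow> real) \<Rightarrow> 'i \<Rightarrow> 'i \<Rightarrow> real" where
  "sigma_fun u s t = sqrt (u s s + u t t - 2 * sqrt (u s t * u t s))"

text \<open>
  Quotients that may have a zero denominator are to be formed in \<^typ>\<open>ereal\<close>, where \<open>0 / 0 = 0\<close> but
  \<open>x / 0 = \<infinity>\<close> for \<open>x > 0\<close>; division on \<^typ>\<open>real\<close> would also give \<open>x / 0 = 0\<close> for \<open>x \<noteq> 0\<close>.
\<close>

end

theory Submission
  imports Defs "HOL-Complex_Analysis.Cauchy_Integral_Formula"
begin

text \<open>
  Write \<open>Y\<close> for the variable at \<open>0\<close>, \<open>Z\<close> for the one at \<open>t n\<close>, \<open>\<sigma> = \<sigma>(t n, 0)\<close> and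
  \<open>d n = \<sigma> * sqrt (ln n)\<close>.  All three statements follow, pointwise, from one bound
  (\<open>permanental_sqrt_increments\<close>): almost surely, for every \<open>\<epsilon> > 0\<close>,
  \<open>\<bar>sqrt Z - sqrt Y\<bar> \<le> (1 + \<epsilon>) * d n\<close> for all large \<open>n\<close>.  One then factors
  \<open>Z - Y = (sqrt Z - sqrt Y) * (sqrt Z + sqrt Y)\<close>.

  Only the law of the pair \<open>(Z, Y)\<close> matters, and its Laplace transform is
  \<open>(1 + a * s + b * r + D * s * r) powr - \<alpha>\<close> with \<open>D = a * b - c\<close>, where \<open>c\<close> is the product of the
  two off-diagonal entries.  In the case \<open>b > 0\<close> put \<open>q = sqrt c / b\<close> and \<open>v = a - c / b\<close>.
  Conditionally on \<open>Y\<close>, the variable \<open>Z\<close> is then distributed like a noncentral chi-square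
  variable, up to scale: \<open>sqrt Z\<close> fluctuates around \<open>q * sqrt Y\<close> on the scale \<open>sqrt v\<close>, with tails
  \<open>exp (- (\<mu>\<^sup>2 / v))\<close>.  Conditioning is replaced by the identity
  \<open>E exp (\<theta> * Z - q\<^sup>2 * \<theta> / (1 - v * \<theta>) * Y) = (1 - v * \<theta>) powr - \<alpha>\<close>, which holds for \<open>\<theta>\<close> of either
  sign as long as \<open>v * \<theta> < 1\<close>.  It involves the Laplace transform at arguments of mixed sign; it
  extends there because it is the sum of a power series with nonnegative coefficients
  (\<open>laplace_gamma_extend\<close>, \<open>bivariate_gamma_mixed\<close>).

  The best \<open>\<theta>\<close> in Chernoff's bound depends on the value of \<open>Y\<close>.  But \<open>Y\<close> is the same variable for
  all \<open>n\<close>, so it is enough to work on each of the countably many events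
  \<open>m \<le> sqrt Y \<le> (1 + \<delta>) * m\<close> with \<open>m\<close> rational, and on such an event one \<open>\<theta>\<close> for each \<open>n\<close> suffices
  (\<open>bivariate_gamma_upper_tail\<close>, \<open>bivariate_gamma_lower_tail\<close>).  Finally
  \<open>\<sigma>\<^sup>2 = v + b * (1 - q)\<^sup>2\<close>.  Hence \<open>v \<le> \<sigma>\<^sup>2\<close>, which makes the tails at \<open>(1 + \<epsilon>) * d n\<close> summable, and
  \<open>\<bar>1 - q\<bar> * sqrt Y \<le> \<sigma> * sqrt (Y / b)\<close>, which is negligible against \<open>d n\<close>; so \<open>q * sqrt Y\<close> may be
  replaced by \<open>sqrt Y\<close>.
\<close>

section \<open>Laplace transforms of gamma type beyond the origin\<close>

text \<open>
  Monotone convergence will give the equality of two power series only for nonnegative arguments,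
  so the uniqueness theorem is needed in this one-sided form.  It holds because the zeros of a
  power series that does not vanish identically are isolated.
\<close>

lemma powser_coeffs_unique_right:
  fixes a c :: "nat \<Rightarrow> real"
  assumes r: "0 < r"
    and a: "\<And>h. 0 \<le> h \<Longrightarrow> h < r \<Longrightarrow> (\<lambda>k. a k * h ^ k) sums f h"
    and c: "\<And>h. 0 \<le> h \<Longrightarrow> h < r \<Longrightarrow> (\<lambda>k. c k * h ^ k) sums f h"
  shows "a = c"
proof (rule ccontr)
  assume "a \<noteq> c"
  define d where "d k = a k - c k" for k
  obtain m where m: "d m \<noteq> 0"
    using \<open>a \<noteq> c\<close> by (auto simp: d_def)
  have d: "(\<lambda>k. d k * h ^ k) sums 0" if "0 \<le> h" "h < r" for h
    using sums_diff[OF a c, of h h] that by (simp add: d_def algebra_simps)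
  have "d 0 = 0"
    using d[of 0] r powser_sums_zero[of d] sums_unique2 by fastforce
  then have "m > 0"
    using m by (cases m) auto
  have summ: "(\<lambda>k. d k * (x - 0) ^ k) sums (\<Sum>k. d k * x ^ k)" if "norm (x - 0) < r" for x
  proof -
    have "summable (\<lambda>k. d k * ((\<bar>x\<bar> + r) / 2) ^ k)"
      using d[of "(\<bar>x\<bar> + r) / 2"] that r by (auto simp: sums_iff)
    then have "summable (\<lambda>k. d k * x ^ k)"
      by (rule powser_inside) (use that r in auto)
    then show ?thesis
      by (simp add: summable_sums)
  qed
  obtain s where s: "0 < s" "\<And>z. z \<in> cball 0 s - {0} \<Longrightarrow> (\<Sum>k. d k * z ^ k) \<noteq> 0"
    by (rule powser_0_nonzero[OF r summ _ m \<open>m > 0\<close>])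
       (use \<open>d 0 = 0\<close> in \<open>auto simp: powser_zero\<close>)
  have "(\<Sum>k. d k * (min s (r / 2)) ^ k) \<noteq> 0"
    using s r by (intro s(2)) auto
  moreover have "(\<Sum>k. d k * (min s (r / 2)) ^ k) = 0"
    using d[of "min s (r / 2)"] s(1) r by (simp add: sums_iff min_less_iff_disj)
  ultimately show False by simp
qed

text \<open>
  Expanding \<open>exp (h * X)\<close> under the integral of \<open>W * exp (- X)\<close> gives a power series in \<open>h\<close> with
  nonnegative coefficients \<open>m k\<close>, and monotone convergence makes the expansion valid for every
  \<open>h \<ge> 0\<close>, whether or not the integral is finite.  The hypothesis identifies the sum with a binomial
  series for \<open>h < 1\<close>, hence the coefficients with binomial ones, and that series converges up to the
  singularity of \<open>(A + B - B * h) powr - \<alpha>\<close>.  Take \<open>h = 1 + \<theta>\<close>.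
\<close>

lemma laplace_gamma_extend:
  fixes X W :: "'w \<Rightarrow> real"
  assumes [measurable]: "X \<in> borel_measurable M" "W \<in> borel_measurable M"
    and X0: "AE \<omega> in M. 0 \<le> X \<omega>" and W0: "AE \<omega> in M. 0 \<le> W \<omega>"
    and A: "0 < A" and B: "0 \<le> B"
    and L: "\<And>s. 0 < s \<Longrightarrow>
      (\<integral>\<^sup>+\<omega>. ennreal (W \<omega> * exp (- s * X \<omega>)) \<partial>M) = ennreal ((A + B * s) powr - \<alpha>)"
    and \<theta>: "0 \<le> \<theta>" "B * \<theta> < A"
  shows "(\<integral>\<^sup>+\<omega>. ennreal (W \<omega> * exp (\<theta> * X \<omega>)) \<partial>M) = ennreal ((A - B * \<theta>) powr - \<alpha>)"
proof -
  define g where "g k \<omega> = W \<omega> * exp (- X \<omega>) * (X \<omega> ^ k / fact k)" for k \<omega>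
  define m where "m k = (\<integral>\<^sup>+\<omega>. ennreal (g k \<omega>) \<partial>M)" for k
  have [measurable]: "g k \<in> borel_measurable M" for k
    unfolding g_def by measurable
  have expand: "(\<integral>\<^sup>+\<omega>. ennreal (W \<omega> * exp ((h - 1) * X \<omega>)) \<partial>M) = (\<Sum>k. m k * ennreal (h ^ k))"
    if "0 \<le> h" for h
  proof -
    have "AE \<omega> in M. ennreal (W \<omega> * exp ((h - 1) * X \<omega>)) = (\<Sum>k. ennreal (g k \<omega>) * ennreal (h ^ k))"
      using X0 W0
    proof eventually_elim
      case (elim \<omega>)
      have "(\<lambda>k. (W \<omega> * exp (- X \<omega>)) * ((h * X \<omega>) ^ k /\<^sub>R fact k)) sums
            ((W \<omega> * exp (- X \<omega>)) * exp (h * X \<omega>))"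
        by (intro sums_mult exp_converges)
      also have "(\<lambda>k. (W \<omega> * exp (- X \<omega>)) * ((h * X \<omega>) ^ k /\<^sub>R fact k)) = (\<lambda>k. g k \<omega> * h ^ k)"
        by (auto simp: g_def fun_eq_iff power_mult_distrib field_simps)
      also have "(W \<omega> * exp (- X \<omega>)) * exp (h * X \<omega>) = W \<omega> * exp ((h - 1) * X \<omega>)"
        by (simp add: mult.assoc algebra_simps flip: exp_add)
      finally have "(\<Sum>k. ennreal (g k \<omega> * h ^ k)) = ennreal (W \<omega> * exp ((h - 1) * X \<omega>))"
        using elim that by (intro suminf_ennreal_eq) (auto simp: g_def)
      moreover have "ennreal (g k \<omega> * h ^ k) = ennreal (g k \<omega>) * ennreal (h ^ k)" for k
        using elim that by (intro ennreal_mult) (auto simp: g_def)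
      ultimately show ?case
        by simp
    qed
    then have "(\<integral>\<^sup>+\<omega>. ennreal (W \<omega> * exp ((h - 1) * X \<omega>)) \<partial>M)
        = (\<integral>\<^sup>+\<omega>. (\<Sum>k. ennreal (g k \<omega>) * ennreal (h ^ k)) \<partial>M)"
      by (rule nn_integral_cong_AE)
    also have "\<dots> = (\<Sum>k. m k * ennreal (h ^ k))"
      by (subst nn_integral_suminf) (auto simp: nn_integral_multc m_def)
    finally show ?thesis .
  qed
  have series: "(\<Sum>k. m k * ennreal (h ^ k)) = ennreal ((A + B - B * h) powr - \<alpha>)"
    if "0 \<le> h" "h < 1" for h
    using expand[of h] L[of "1 - h"] that by (simp add: algebra_simps)
  have fin: "m k \<noteq> \<infinity>" for k
  proof
    assume "m k = \<infinity>"
    then have "m k * ennreal ((1 / 2) ^ k) = \<infinity>"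
      by (simp add: ennreal_top_mult)
    moreover have "m k * ennreal ((1 / 2) ^ k) \<le> (\<Sum>k. m k * ennreal ((1 / 2) ^ k))"
      using sum_le_suminf[of "\<lambda>k. m k * ennreal ((1 / 2) ^ k)" "{k}"] by simp
    ultimately show False
      using series[of "1 / 2"] by (simp add: top_unique)
  qed
  define m' where "m' k = enn2real (m k)" for k
  have m': "m k = ennreal (m' k)" "0 \<le> m' k" for k
    using fin[of k] by (simp_all add: m'_def less_top)
  have eqterm: "m k * ennreal (h ^ k) = ennreal (m' k * h ^ k)" if "0 \<le> h" for h k
    using that m'[of k] by (simp add: ennreal_mult)
  define c where "c k = (- \<alpha> gchoose k) * (A + B) powr (- \<alpha> - real k) * (- B) ^ k" for k
  have c: "(\<lambda>k. c k * h ^ k) sums ((A + B - B * h) powr - \<alpha>)" if "0 \<le> h" "B * h < A + B" for h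
  proof -
    have "\<bar>- B * h\<bar> < A + B"
      using that A B by (simp add: abs_mult)
    from gen_binomial_real''[OF this, of "- \<alpha>"] show ?thesis
      unfolding c_def by (simp only: power_mult_distrib mult.assoc) simp
  qed
  have "m' = c"
  proof (rule powser_coeffs_unique_right[of 1])
    fix h :: real assume h: "0 \<le> h" "h < 1"
    have S: "(\<Sum>k. ennreal (m' k * h ^ k)) = ennreal ((A + B - B * h) powr - \<alpha>)"
      using series[OF h] by (simp add: eqterm h)
    have summ: "summable (\<lambda>k. m' k * h ^ k)"
      using S h m'(2) by (intro summable_suminf_not_top) auto
    have "ennreal (\<Sum>k. m' k * h ^ k) = ennreal ((A + B - B * h) powr - \<alpha>)"
      using S by (subst (asm) suminf_ennreal2[OF _ summ]) (simp_all add: h m'(2))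
    moreover have "0 \<le> (\<Sum>k. m' k * h ^ k)"
      using h m'(2) summ by (intro suminf_nonneg) auto
    ultimately have "(\<Sum>k. m' k * h ^ k) = (A + B - B * h) powr - \<alpha>"
      by (subst (asm) ennreal_inj) simp_all
    then show "(\<lambda>k. m' k * h ^ k) sums ((A + B - B * h) powr - \<alpha>)"
      using summ by (simp add: sums_iff)
    have "B * h \<le> B * 1"
      using h B by (intro mult_left_mono) auto
    then show "(\<lambda>k. c k * h ^ k) sums ((A + B - B * h) powr - \<alpha>)"
      using h A by (intro c) auto
  qed simp
  moreover have "B * (1 + \<theta>) < A + B"
    using \<theta> by (simp add: distrib_left)
  ultimately have "(\<lambda>k. m' k * (1 + \<theta>) ^ k) sums ((A + B - B * (1 + \<theta>)) powr - \<alpha>)"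
    using \<theta>(1) c[of "1 + \<theta>"] by simp
  then have "(\<Sum>k. ennreal (m' k * (1 + \<theta>) ^ k)) = ennreal ((A + B - B * (1 + \<theta>)) powr - \<alpha>)"
    using \<theta> m'(2) by (intro suminf_ennreal_eq) auto
  then show ?thesis
    using expand[of "1 + \<theta>"] \<theta> by (simp add: eqterm algebra_simps)
qed

section \<open>Permanental pairs\<close>

text \<open>
  Both marginals are gamma distributions with shape \<open>\<alpha>\<close>.  For a permanental pair with kernel
  \<open>u\<close>, the number \<open>D\<close> is the determinant of the kernel.  Arguments \<open>0\<close> are included, so that the
  marginal laws need no separate treatment.  The integral is taken in \<^typ>\<open>ennreal\<close> because its
  extension to arguments of mixed sign is obtained by monotone convergence.
\<close>

definition bivariate_gamma ::
    "'w measure \<Rightarrow> real \<Rightarrow> real \<Rightarrow> real \<Rightarrow> real \<Rightarrow> ('w \<Rightarrow> real) \<Rightarrow> ('w \<Rightarrow> real) \<Rightarrow> bool" where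
  "bivariate_gamma M \<alpha> a b D X Y \<longleftrightarrow>
     X \<in> borel_measurable M \<and> Y \<in> borel_measurable M \<and>
     (AE \<omega> in M. 0 \<le> X \<omega>) \<and> (AE \<omega> in M. 0 \<le> Y \<omega>) \<and> 0 \<le> a \<and> 0 \<le> b \<and> 0 \<le> D \<and>
     (\<forall>s\<ge>0. \<forall>r\<ge>0. (\<integral>\<^sup>+\<omega>. ennreal (exp (- s * X \<omega>) * exp (- r * Y \<omega>)) \<partial>M) =
        ennreal ((1 + a * s + b * r + D * s * r) powr - \<alpha>))"

lemma bivariate_gamma_swap:
  "bivariate_gamma M \<alpha> a b D X Y \<Longrightarrow> bivariate_gamma M \<alpha> b a D Y X"
  unfolding bivariate_gamma_def
proof (elim conjE, intro conjI allI impI)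
  fix s r :: real assume "0 \<le> s" "0 \<le> r"
    and "\<forall>s\<ge>0. \<forall>r\<ge>0. (\<integral>\<^sup>+\<omega>. ennreal (exp (- s * X \<omega>) * exp (- r * Y \<omega>)) \<partial>M) =
        ennreal ((1 + a * s + b * r + D * s * r) powr - \<alpha>)"
  then have "(\<integral>\<^sup>+\<omega>. ennreal (exp (- r * X \<omega>) * exp (- s * Y \<omega>)) \<partial>M) =
        ennreal ((1 + a * r + b * s + D * r * s) powr - \<alpha>)"
    by blast
  then show "(\<integral>\<^sup>+\<omega>. ennreal (exp (- s * Y \<omega>) * exp (- r * X \<omega>)) \<partial>M) =
        ennreal ((1 + b * s + a * r + D * s * r) powr - \<alpha>)"
    by (simp add: mult_ac add_ac)
qed auto

lemma bivariate_gamma_mixed: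
  assumes "bivariate_gamma M \<alpha> a b D X Y" "0 \<le> s" "0 \<le> \<rho>" "(b + D * s) * \<rho> < 1 + a * s"
  shows "(\<integral>\<^sup>+\<omega>. ennreal (exp (- s * X \<omega>) * exp (\<rho> * Y \<omega>)) \<partial>M) =
    ennreal ((1 + a * s - (b + D * s) * \<rho>) powr - \<alpha>)"
proof -
  have nn: "0 \<le> a" "0 \<le> b" "0 \<le> D"
    using assms(1) by (auto simp: bivariate_gamma_def)
  have [measurable]: "X \<in> borel_measurable M" "Y \<in> borel_measurable M"
    using assms(1) by (auto simp: bivariate_gamma_def)
  show ?thesis
  proof (rule laplace_gamma_extend)
    fix r :: real assume "0 < r"
    then have "(\<integral>\<^sup>+\<omega>. ennreal (exp (- s * X \<omega>) * exp (- r * Y \<omega>)) \<partial>M) =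
        ennreal ((1 + a * s + b * r + D * s * r) powr - \<alpha>)"
      using assms(1,2) unfolding bivariate_gamma_def by auto
    then show "(\<integral>\<^sup>+\<omega>. ennreal (exp (- s * X \<omega>) * exp (- r * Y \<omega>)) \<partial>M) =
        ennreal ((1 + a * s + (b + D * s) * r) powr - \<alpha>)"
      by (simp add: algebra_simps)
  next
    show "0 < 1 + a * s" "0 \<le> b + D * s"
      using nn assms(2) by (auto intro: add_pos_nonneg)
  qed (use assms in \<open>auto simp: bivariate_gamma_def\<close>)
qed

text \<open>
  In terms of the kernel this says \<open>u x y * u y x \<ge> 0\<close>.  If \<open>D > a * b\<close>, then
  \<open>E (exp (\<rho> * Y - X))\<close> blows up at \<open>\<rho> = (1 + a) / (b + D) < 1 / b\<close>, although it is bounded by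
  \<open>E (exp (\<rho> * Y))\<close>, which is finite there.
\<close>

lemma bivariate_gamma_cross_le:
  assumes bg: "bivariate_gamma M \<alpha> a b D X Y" and \<alpha>: "0 < \<alpha>"
  shows "D \<le> a * b"
proof (rule ccontr)
  assume "\<not> D \<le> a * b"
  then have D: "a * b < D" by simp
  have nn: "0 \<le> a" "0 \<le> b"
    using bg by (auto simp: bivariate_gamma_def)
  have "0 < D"
    using D nn by (meson le_less_trans mult_nonneg_nonneg)
  define \<rho>0 where "\<rho>0 = (1 + a) / (b + D)"
  have "a / D < \<rho>0"
    using \<open>0 < D\<close> D nn by (auto simp: \<rho>0_def field_simps)
  (* Below \<rho>0 the expectation is still finite; above a / D its closed form exceeds the bound. *)
  then obtain \<rho> where \<rho>: "a / D < \<rho>" "\<rho> < \<rho>0"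
    using dense by blast
  have "0 \<le> a / D"
    using nn \<open>0 < D\<close> by simp
  then have "0 \<le> \<rho>"
    using \<rho>(1) by linarith
  have 1: "(b + D) * \<rho> < 1 + a"
    using \<rho>(2) \<open>0 < D\<close> nn by (simp add: \<rho>0_def field_simps)
  have 2: "a < D * \<rho>"
    using \<rho>(1) \<open>0 < D\<close> by (simp add: field_simps)
  have "(1 + a - (b + D) * \<rho>) powr - \<alpha> \<le> (1 - b * \<rho>) powr - \<alpha>"
  proof -
    have "ennreal ((1 + a * 1 - (b + D * 1) * \<rho>) powr - \<alpha>) =
        (\<integral>\<^sup>+\<omega>. ennreal (exp (- 1 * X \<omega>) * exp (\<rho> * Y \<omega>)) \<partial>M)"
      using 1 \<open>0 \<le> \<rho>\<close> by (intro bivariate_gamma_mixed[OF bg, symmetric]) auto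
    also have "\<dots> \<le> (\<integral>\<^sup>+\<omega>. ennreal (exp (- 0 * X \<omega>) * exp (\<rho> * Y \<omega>)) \<partial>M)"
      using bg by (intro nn_integral_mono_AE) (auto simp: bivariate_gamma_def intro!: ennreal_leI)
    also have "\<dots> = ennreal ((1 + a * 0 - (b + D * 0) * \<rho>) powr - \<alpha>)"
      using 1 2 \<open>0 \<le> \<rho>\<close> by (intro bivariate_gamma_mixed[OF bg]) (auto simp: algebra_simps)
    finally show ?thesis by simp
  qed
  moreover have "(1 - b * \<rho>) powr - \<alpha> < (1 + a - (b + D) * \<rho>) powr - \<alpha>"
    using 1 2 \<alpha> by (intro powr_less_mono2_neg) (auto simp: algebra_simps)
  ultimately show False by simp
qed

lemma det_mat_2:
  "Determinant.det (Matrix.mat 2 2 f) = f (0, 0) * f (1, 1) - f (0, 1) * f (1, 0 :: nat)"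
proof -
  have "Determinant.det (Matrix.mat 2 2 f) = (\<Sum>i<2. Matrix.mat 2 2 f $$ (i, 0) * cofactor (Matrix.mat 2 2 f) i 0)"
    by (intro laplace_expansion_column) auto
  also have "\<dots> = f (0, 0) * f (1, 1) - f (0, 1) * f (1, 0)"
    by (simp add: numeral_2_eq_2 cofactor_def mat_delete_def det_single insert_index_def)
  finally show ?thesis .
qed

text \<open>
  The Laplace transform is positive, so \<open>1 + a * s + b * r + D * s * r\<close> has no zero with
  \<open>s, r \<ge> 0\<close>.  This forces \<open>a\<close>, \<open>b\<close> and \<open>D\<close> to be nonnegative.
\<close>

lemma permanental_process_bivariate_gamma:
  assumes "prob_space M" and perm: "permanental_process M \<alpha> T u X"
    and T: "x \<in> T" "y \<in> T"
  shows "bivariate_gamma M \<alpha> (u x x) (u y y) (u x x * u y y - u x y * u y x) (X x) (X y)"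
proof -
  interpret prob_space M by fact
  have vec: "permanental_vector M \<alpha> n (Matrix.mat n n (\<lambda>(i, j). u (r i) (r j))) (\<lambda>i. X (r i))"
    if "\<And>i. i < n \<Longrightarrow> r i \<in> T" for n r
    using perm that unfolding permanental_process_def by blast
  have basic: "X z \<in> borel_measurable M" "AE \<omega> in M. 0 \<le> X z \<omega>"
    and laplace1: "\<And>s. 0 < s \<Longrightarrow> (\<integral>\<omega>. exp (- s * X z \<omega>) \<partial>M) = (1 + u z z * s) powr - \<alpha>"
    if "z \<in> T" for z
  proof -
    note v = vec[of 1 "\<lambda>_. z", unfolded permanental_vector_def, OF that]
    show "X z \<in> borel_measurable M" "AE \<omega> in M. 0 \<le> X z \<omega>"
      using v by auto
    fix s :: real assume "0 < s"
    then have "(\<integral>\<omega>. exp (- (\<Sum>i<1::nat. s * X z \<omega>)) \<partial>M) =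
        Determinant.det (1\<^sub>m 1 + Matrix.mat 1 1 (\<lambda>(i, j). u z z) * mat_diag 1 (\<lambda>_. s)) powr - \<alpha>"
      using v by (elim conjE allE[of _ "\<lambda>_. s"]) auto
    then show "(\<integral>\<omega>. exp (- s * X z \<omega>) \<partial>M) = (1 + u z z * s) powr - \<alpha>"
      by (subst (asm) det_single) (auto simp: mat_diag_mult_right[where n = "Suc 0" and nr = "Suc 0"])
  qed
  note [measurable] = basic(1)[OF T(1)] basic(1)[OF T(2)]
  have laplace2: "(\<integral>\<omega>. exp (- s * X x \<omega>) * exp (- r * X y \<omega>) \<partial>M) =
      (1 + u x x * s + u y y * r + (u x x * u y y - u x y * u y x) * s * r) powr - \<alpha>"
    if "0 < s" "0 < r" for s r
  proof -
    define p where "p i = (if i = (0 :: nat) then x else y)" for i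
    define q where "q i = (if i = (0 :: nat) then s else r)" for i
    have "permanental_vector M \<alpha> 2 (Matrix.mat 2 2 (\<lambda>(i, j). u (p i) (p j))) (\<lambda>i. X (p i))"
      by (rule vec) (use T in \<open>auto simp: p_def\<close>)
    moreover have "\<forall>i<2. 0 < q i"
      using that by (auto simp: q_def)
    ultimately have "(\<integral>\<omega>. exp (- (\<Sum>i<2. q i * X (p i) \<omega>)) \<partial>M) =
        Determinant.det (1\<^sub>m 2 + Matrix.mat 2 2 (\<lambda>(i, j). u (p i) (p j)) * mat_diag 2 q) powr - \<alpha>"
      unfolding permanental_vector_def by blast
    also have "1\<^sub>m 2 + Matrix.mat 2 2 (\<lambda>(i, j). u (p i) (p j)) * mat_diag 2 q =
        Matrix.mat 2 2 (\<lambda>(i, j). (if i = j then 1 else 0) + u (p i) (p j) * q j)"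
      by (subst mat_diag_mult_right) (auto intro!: eq_matI)
    also have "Determinant.det \<dots> = (1 + u x x * s) * (1 + u y y * r) - u x y * r * (u y x * s)"
      by (subst det_mat_2) (simp add: p_def q_def)
    also have "(\<lambda>\<omega>. exp (- (\<Sum>i<2. q i * X (p i) \<omega>))) = (\<lambda>\<omega>. exp (- s * X x \<omega>) * exp (- r * X y \<omega>))"
      by (auto simp: numeral_2_eq_2 p_def q_def fun_eq_iff simp flip: exp_add)
    finally show ?thesis by (simp add: algebra_simps)
  qed
  have integrable: "integrable M (\<lambda>\<omega>. exp (- s * X x \<omega>) * exp (- r * X y \<omega>))"
    if "0 \<le> s" "0 \<le> r" for s r
  proof (rule integrable_const_bound)
    show "AE \<omega> in M. norm (exp (- s * X x \<omega>) * exp (- r * X y \<omega>)) \<le> 1"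
      using basic(2)[OF T(1)] basic(2)[OF T(2)]
      by eventually_elim (use that in \<open>auto intro!: mult_le_one\<close>)
  qed simp
  have pos: "(\<integral>\<omega>. exp (- s * X x \<omega>) * exp (- r * X y \<omega>) \<partial>M) \<noteq> 0" if "0 \<le> s" "0 \<le> r" for s r
    using integral_nonneg_eq_0_iff_AE[OF integrable[OF that]] prob_space by (auto simp: AE_False)
  define a where "a = u x x"
  define b where "b = u y y"
  define D where "D = u x x * u y y - u x y * u y x"
  have laplace: "(\<integral>\<omega>. exp (- s * X x \<omega>) * exp (- r * X y \<omega>) \<partial>M) = (1 + a * s + b * r + D * s * r) powr - \<alpha>"
    if "0 \<le> s" "0 \<le> r" for s r
  proof (cases "s = 0"; cases "r = 0")
    assume "s = 0" "r = 0"
    then show ?thesis by (simp add: prob_space)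
  next
    assume "s = 0" "r \<noteq> 0"
    then show ?thesis
      using laplace1[OF T(2), of r] that by (simp add: b_def)
  next
    assume "s \<noteq> 0" "r = 0"
    then show ?thesis
      using laplace1[OF T(1), of s] that by (simp add: a_def)
  next
    assume "s \<noteq> 0" "r \<noteq> 0"
    then show ?thesis
      using laplace2[of s r] that by (simp add: a_def b_def D_def)
  qed
  have nz: "1 + a * s + b * r + D * s * r \<noteq> 0" if "0 \<le> s" "0 \<le> r" for s r
  proof
    assume "1 + a * s + b * r + D * s * r = 0"
    then have "(\<integral>\<omega>. exp (- s * X x \<omega>) * exp (- r * X y \<omega>) \<partial>M) = 0"
      using laplace[OF that] by (simp only: powr_0)
    then show False
      using pos[OF that] by simp
  qed
  have a: "0 \<le> a"
    using nz[of "- 1 / a" 0] by (cases "a < 0") (auto simp: field_simps)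
  have b: "0 \<le> b"
    using nz[of 0 "- 1 / b"] by (cases "b < 0") (auto simp: field_simps)
  have D: "0 \<le> D"
  proof (rule ccontr)
    assume "\<not> 0 \<le> D"
    then have "D < 0" by simp
    (* This r makes the coefficient of s equal to -1, and then s = 1 + b * r is a zero. *)
    define r where "r = (a + 1) / (- D)"
    have "0 \<le> r"
      using \<open>D < 0\<close> a unfolding r_def by (intro divide_nonneg_nonneg) auto
    have "a + D * r = - 1"
      using \<open>D < 0\<close> by (simp add: r_def field_simps)
    moreover have "1 + a * (1 + b * r) + b * r + D * (1 + b * r) * r = (1 + b * r) * (1 + (a + D * r))"
      by (simp add: algebra_simps)
    ultimately have "1 + a * (1 + b * r) + b * r + D * (1 + b * r) * r = 0"
      by simp
    then show False
      using nz[of "1 + b * r" r] b \<open>0 \<le> r\<close> by simp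
  qed
  have "(\<integral>\<^sup>+\<omega>. ennreal (exp (- s * X x \<omega>) * exp (- r * X y \<omega>)) \<partial>M) =
      ennreal ((1 + a * s + b * r + D * s * r) powr - \<alpha>)" if "0 \<le> s" "0 \<le> r" for s r
    using nn_integral_eq_integral[OF integrable[OF that]] laplace[OF that] by simp
  then show ?thesis
    using a b D basic[OF T(1)] basic[OF T(2)]
    unfolding bivariate_gamma_def D_def[symmetric] unfolding a_def[symmetric] b_def[symmetric] by auto
qed

section \<open>Tail bounds for the difference of the square roots\<close>

lemma (in finite_measure) exponential_Markov:
  assumes [measurable]: "A \<in> sets M" "G \<in> borel_measurable M"
    and G: "\<And>\<omega>. \<omega> \<in> A \<Longrightarrow> exp z \<le> G \<omega>"
    and K: "(\<integral>\<^sup>+\<omega>. ennreal (G \<omega>) \<partial>M) \<le> ennreal K" "0 \<le> K"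
  shows "measure M A \<le> K * exp (- z)"
proof -
  have "emeasure M A = (\<integral>\<^sup>+\<omega>. indicator A \<omega> \<partial>M)"
    by simp
  also have "\<dots> \<le> (\<integral>\<^sup>+\<omega>. ennreal (exp (- z)) * ennreal (G \<omega>) \<partial>M)"
  proof (rule nn_integral_mono)
    fix \<omega>
    show "indicator A \<omega> \<le> ennreal (exp (- z)) * ennreal (G \<omega>)"
    proof (cases "\<omega> \<in> A")
      case True
      have "1 \<le> exp (- z) * G \<omega>"
        using G[OF True] by (simp add: exp_minus field_simps)
      then have "ennreal 1 \<le> ennreal (exp (- z) * G \<omega>)"
        by (rule ennreal_leI)
      then show ?thesis
        using True by (simp add: ennreal_mult')
    qed simp
  qed
  also have "\<dots> \<le> ennreal (exp (- z)) * ennreal K"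
    using K(1) by (simp add: nn_integral_cmult mult_left_mono)
  also have "\<dots> = ennreal (K * exp (- z))"
    using K(2) by (simp add: ennreal_mult' mult.commute)
  finally show ?thesis
    using K(2) by (simp add: emeasure_eq_measure)
qed

text \<open>
  This inequality and \<open>lower_exponent\<close> measure the loss in Chernoff's bound when the exponent is optimal for
  \<open>q * sqrt Y = w'\<close> while in fact \<open>q * sqrt Y = w\<close>: with \<open>x\<close> on the boundary of its range, the
  right-hand side equals \<open>\<mu>\<^sup>2 * (1 - (w - w')\<^sup>2 / (w' * (w' + \<mu>)))\<close>, with \<open>- \<mu>\<close> for \<open>\<mu>\<close> in the
  denominator for the lower tail.
\<close>

lemma upper_exponent:
  fixes w w' \<mu> d x :: real
  assumes "0 < w'" "0 < \<mu>" "(w - w')\<^sup>2 \<le> d * (w' * (w' + \<mu>))" "(w + \<mu>)\<^sup>2 \<le> x"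
  shows "(1 - d) * \<mu>\<^sup>2 \<le> \<mu> / (w' + \<mu>) * (x - w\<^sup>2 * (w' + \<mu>) / w')"
proof -
  have "(1 - d) * \<mu>\<^sup>2 \<le> \<mu>\<^sup>2 - \<mu>\<^sup>2 * ((w - w')\<^sup>2 / (w' * (w' + \<mu>)))"
  proof -
    have "(w - w')\<^sup>2 / (w' * (w' + \<mu>)) \<le> d"
      using assms(1-3) by (simp add: pos_divide_le_eq)
    then have "\<mu>\<^sup>2 * ((w - w')\<^sup>2 / (w' * (w' + \<mu>))) \<le> \<mu>\<^sup>2 * d"
      by (intro mult_left_mono) auto
    then show ?thesis by (simp add: algebra_simps)
  qed
  also have "\<dots> = \<mu> / (w' + \<mu>) * ((w + \<mu>)\<^sup>2 - w\<^sup>2 * (w' + \<mu>) / w')"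
  proof -
    have "w' + \<mu> \<noteq> 0" "w' \<noteq> 0" using assms(1,2) by auto
    then show ?thesis by (simp add: divide_simps) (simp add: algebra_simps power2_eq_square)
  qed
  also have "\<dots> \<le> \<mu> / (w' + \<mu>) * (x - w\<^sup>2 * (w' + \<mu>) / w')"
    using assms by (intro mult_left_mono) auto
  finally show ?thesis .
qed

lemma lower_exponent:
  fixes w w' \<mu> d x :: real
  assumes "0 < \<mu>" "\<mu> < w'" "(w - w')\<^sup>2 \<le> d * (w' * (w' - \<mu>))" "x \<le> (w - \<mu>)\<^sup>2"
  shows "(1 - d) * \<mu>\<^sup>2 \<le> \<mu> / (w' - \<mu>) * (w\<^sup>2 * (w' - \<mu>) / w' - x)"
proof -
  have "(1 - d) * \<mu>\<^sup>2 \<le> \<mu>\<^sup>2 - \<mu>\<^sup>2 * ((w - w')\<^sup>2 / (w' * (w' - \<mu>)))"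
  proof -
    have "(w - w')\<^sup>2 / (w' * (w' - \<mu>)) \<le> d"
      using assms(1-3) by (simp add: pos_divide_le_eq)
    then have "\<mu>\<^sup>2 * ((w - w')\<^sup>2 / (w' * (w' - \<mu>))) \<le> \<mu>\<^sup>2 * d"
      by (intro mult_left_mono) auto
    then show ?thesis by (simp add: algebra_simps)
  qed
  also have "\<dots> = \<mu> / (w' - \<mu>) * (w\<^sup>2 * (w' - \<mu>) / w' - (w - \<mu>)\<^sup>2)"
  proof -
    have "w' - \<mu> \<noteq> 0" "w' \<noteq> 0" using assms(1,2) by auto
    then show ?thesis by (simp add: divide_simps) (simp add: algebra_simps power2_eq_square)
  qed
  also have "\<dots> \<le> \<mu> / (w' - \<mu>) * (w\<^sup>2 * (w' - \<mu>) / w' - x)"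
    using assms by (intro mult_left_mono) auto
  finally show ?thesis .
qed

text \<open>
  Chernoff's bound with the exponent that is optimal for \<open>q * sqrt Y = w'\<close>.  The summand
  \<open>\<delta>\<^sup>2 * \<mu>\<close> of \<open>w'\<close> keeps \<open>1 - V * \<theta> = w' / (w' + \<mu>)\<close> away from \<open>0\<close>, and with it the constant in
  front of the exponential, uniformly in \<open>q\<close> and \<open>m\<close>.  Any \<open>V \<ge> v\<close> may take the place of \<open>v\<close>; this
  avoids a division by \<open>0\<close> if \<open>v = 0\<close>.
\<close>

lemma bivariate_gamma_upper_tail:
  assumes "prob_space M"
    and bg: "bivariate_gamma M \<alpha> (v + q\<^sup>2 * b) b (v * b) X Y"
    and \<alpha>: "0 < \<alpha>" and q: "0 \<le> q" and v: "0 \<le> v" "v \<le> V" "0 < V"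
    and \<mu>: "0 < \<mu>" and \<delta>: "0 < \<delta>" "\<delta> \<le> 1" and m: "0 \<le> m"
  shows "measure M {\<omega> \<in> space M. 0 \<le> X \<omega> \<and> 0 \<le> Y \<omega> \<and> m \<le> sqrt (Y \<omega>) \<and>
            sqrt (Y \<omega>) \<le> (1 + \<delta>) * m \<and> q * sqrt (Y \<omega>) + \<mu> \<le> sqrt (X \<omega>)}
         \<le> (\<delta>\<^sup>2 / (1 + \<delta>\<^sup>2)) powr - \<alpha> * exp (- ((1 - \<delta>\<^sup>2) * \<mu>\<^sup>2 / V))"
    (is "measure M ?A \<le> _")
proof -
  interpret prob_space M by fact
  have [measurable]: "X \<in> borel_measurable M" "Y \<in> borel_measurable M"
    using bg by (auto simp: bivariate_gamma_def)
  have b: "0 \<le> b"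
    using bg by (auto simp: bivariate_gamma_def)
  define w' where "w' = q * m + \<delta>\<^sup>2 * \<mu>"
  define \<kappa> where "\<kappa> = w' / (w' + \<mu>)"
  define \<theta> where "\<theta> = (1 - \<kappa>) / V"
  define \<rho> where "\<rho> = q\<^sup>2 * \<theta> / \<kappa>"
  have w': "0 < w'" "q * m \<le> w'" "\<delta>\<^sup>2 * \<mu> \<le> w'"
    using q m \<mu> \<delta> by (auto simp: w'_def intro!: add_nonneg_pos)
  have \<kappa>: "0 < \<kappa>" "\<kappa> < 1"
    using w' \<mu> by (auto simp: \<kappa>_def)
  have "1 - \<kappa> = \<mu> / (w' + \<mu>)"
    using w' \<mu> by (simp add: \<kappa>_def field_simps)
  then have \<theta>_eq: "\<theta> = \<mu> / (w' + \<mu>) / V"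
    by (simp add: \<theta>_def)
  have \<theta>: "0 \<le> \<theta>" and \<rho>: "0 \<le> \<rho>"
    using \<kappa> v by (auto simp: \<theta>_def \<rho>_def)
  have "\<kappa> = 1 - V * \<theta>"
    using v by (simp add: \<theta>_def)
  also have "\<dots> \<le> 1 - v * \<theta>"
    using v \<theta> by (simp add: mult_right_mono)
  finally have \<kappa>_le: "\<kappa> \<le> 1 - v * \<theta>" .
  have \<rho>\<kappa>: "\<rho> * \<kappa> = q\<^sup>2 * \<theta>"
    using \<kappa> by (simp add: \<rho>_def)
  (* K replaces 1 - V * \<theta>, with which it coincides for V = v. *)
  define K where "K = 1 + b * \<rho> - (v + q\<^sup>2 * b + v * b * \<rho>) * \<theta>"
  have "K = 1 + b * \<rho> - v * \<theta> - b * (q\<^sup>2 * \<theta>) - v * b * \<rho> * \<theta>"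
    by (simp add: K_def algebra_simps)
  also have "\<dots> = 1 - v * \<theta> + b * \<rho> * (1 - v * \<theta> - \<kappa>)"
    unfolding \<rho>\<kappa>[symmetric] by (simp add: algebra_simps)
  finally have "K = 1 - v * \<theta> + b * \<rho> * (1 - v * \<theta> - \<kappa>)" .
  moreover have "0 \<le> b * \<rho> * (1 - v * \<theta> - \<kappa>)"
    using b \<rho> \<kappa>_le by simp
  ultimately have "\<kappa> \<le> K"
    using \<kappa>_le by linarith
  have "\<delta>\<^sup>2 / (1 + \<delta>\<^sup>2) \<le> \<kappa>"
  proof -
    have "0 < 1 + \<delta>\<^sup>2" "0 < w' + \<mu>" using \<delta> w' \<mu> by (auto intro: add_pos_nonneg)
    then show ?thesis
      using w' by (simp add: \<kappa>_def divide_simps) (simp add: algebra_simps)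
  qed
  have int: "(\<integral>\<^sup>+\<omega>. ennreal (exp (- \<rho> * Y \<omega>) * exp (\<theta> * X \<omega>)) \<partial>M) = ennreal (K powr - \<alpha>)"
    using bivariate_gamma_mixed[OF bivariate_gamma_swap[OF bg] \<rho> \<theta>] \<kappa> \<open>\<kappa> \<le> K\<close>
    by (simp add: K_def)
  have "measure M ?A \<le> K powr - \<alpha> * exp (- ((1 - \<delta>\<^sup>2) * \<mu>\<^sup>2 / V))"
  proof (rule exponential_Markov)
    fix \<omega> assume "\<omega> \<in> ?A"
    then have \<omega>: "0 \<le> X \<omega>" "0 \<le> Y \<omega>" "m \<le> sqrt (Y \<omega>)" "sqrt (Y \<omega>) \<le> (1 + \<delta>) * m"
      "q * sqrt (Y \<omega>) + \<mu> \<le> sqrt (X \<omega>)" by auto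
    define w where "w = q * sqrt (Y \<omega>)"
    have w: "q * m \<le> w" "w \<le> q * ((1 + \<delta>) * m)"
      unfolding w_def using \<omega> q by (auto intro: mult_left_mono)
    have "(w - w')\<^sup>2 \<le> \<delta>\<^sup>2 * (w' * (w' + \<mu>))"
    proof -
      have "w \<le> q * m + \<delta> * (q * m)"
        using w by (simp add: algebra_simps)
      moreover have "\<delta> * (q * m) \<le> \<delta> * w'"
        using w' \<delta> by (intro mult_left_mono) auto
      ultimately have "w - w' \<le> \<delta> * w'"
        using w' by linarith
      moreover have "- (\<delta>\<^sup>2 * \<mu>) \<le> w - w'"
        using w by (simp add: w'_def)
      ultimately have "\<bar>w - w'\<bar> \<le> max (\<delta> * w') (\<delta>\<^sup>2 * \<mu>)"
        by linarith
      then have "(w - w')\<^sup>2 \<le> (max (\<delta> * w') (\<delta>\<^sup>2 * \<mu>))\<^sup>2"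
        by (metis abs_ge_zero power2_abs power_mono)
      also have "\<dots> \<le> \<delta>\<^sup>2 * (w' * (w' + \<mu>))"
      proof (cases "\<delta> * w' \<le> \<delta>\<^sup>2 * \<mu>")
        case True
        have "\<delta>\<^sup>2 * (\<mu> * (\<delta>\<^sup>2 * \<mu>)) \<le> \<delta>\<^sup>2 * (\<mu> * w')"
          using w' \<mu> by (intro mult_left_mono) auto
        also have "\<dots> \<le> \<delta>\<^sup>2 * (w' * (w' + \<mu>))"
          using w' \<mu> by (intro mult_left_mono) (auto simp: algebra_simps)
        finally show ?thesis
          using True by (simp add: max_def power2_eq_square algebra_simps)
      next
        case False
        have "(\<delta> * w')\<^sup>2 = \<delta>\<^sup>2 * (w' * w')"
          by (simp add: power2_eq_square)
        also have "\<dots> \<le> \<delta>\<^sup>2 * (w' * (w' + \<mu>))"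
          using w' \<mu> by (intro mult_left_mono) auto
        finally have "(\<delta> * w')\<^sup>2 \<le> \<delta>\<^sup>2 * (w' * (w' + \<mu>))" .
        then show ?thesis
          using False by (simp add: max_def)
      qed
      finally show ?thesis .
    qed
    moreover have "(w + \<mu>)\<^sup>2 \<le> X \<omega>"
    proof -
      have "(w + \<mu>)\<^sup>2 \<le> (sqrt (X \<omega>))\<^sup>2"
        using \<omega> q \<mu> by (intro power_mono) (auto simp: w_def)
      then show ?thesis using \<omega> by simp
    qed
    ultimately have "(1 - \<delta>\<^sup>2) * \<mu>\<^sup>2 \<le> \<mu> / (w' + \<mu>) * (X \<omega> - w\<^sup>2 * (w' + \<mu>) / w')"
      using w' \<mu> by (intro upper_exponent) auto
    then have "(1 - \<delta>\<^sup>2) * \<mu>\<^sup>2 / V \<le> \<mu> / (w' + \<mu>) * (X \<omega> - w\<^sup>2 * (w' + \<mu>) / w') / V"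
      using v by (intro divide_right_mono) auto
    also have "\<dots> = \<theta> * (X \<omega> - w\<^sup>2 / \<kappa>)"
      by (simp add: \<theta>_eq \<kappa>_def)
    also have "\<dots> = - \<rho> * Y \<omega> + \<theta> * X \<omega>"
      using \<omega> by (simp add: w_def \<rho>_def power_mult_distrib algebra_simps)
    finally show "exp ((1 - \<delta>\<^sup>2) * \<mu>\<^sup>2 / V) \<le> exp (- \<rho> * Y \<omega>) * exp (\<theta> * X \<omega>)"
      by (simp flip: exp_add)
  qed (use int in auto)
  also have "\<dots> \<le> (\<delta>\<^sup>2 / (1 + \<delta>\<^sup>2)) powr - \<alpha> * exp (- ((1 - \<delta>\<^sup>2) * \<mu>\<^sup>2 / V))"
    using \<open>\<delta>\<^sup>2 / (1 + \<delta>\<^sup>2) \<le> \<kappa>\<close> \<open>\<kappa> \<le> K\<close> \<alpha> \<delta>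
    by (intro mult_right_mono powr_mono2') (auto intro!: divide_pos_pos add_pos_pos)
  finally show ?thesis .
qed

text \<open>
  The event is empty if \<open>\<mu>\<close> exceeds the largest possible value of \<open>q * sqrt Y\<close>.  Otherwise \<open>w'\<close> is
  chosen slightly above that value, which keeps \<open>w' - \<mu>\<close> of order at least \<open>\<delta> * w'\<close>; the
  resulting loss is of order \<open>\<delta>\<close> rather than \<open>\<delta>\<^sup>2\<close>.
\<close>

lemma bivariate_gamma_lower_tail:
  assumes "prob_space M"
    and bg: "bivariate_gamma M \<alpha> (v + q\<^sup>2 * b) b (v * b) X Y"
    and \<alpha>: "0 < \<alpha>" and q: "0 \<le> q" and v: "0 \<le> v" "v \<le> V" "0 < V"
    and \<mu>: "0 < \<mu>" and \<delta>: "0 < \<delta>" "\<delta> \<le> 1" and m: "0 \<le> m"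
  shows "measure M {\<omega> \<in> space M. 0 \<le> X \<omega> \<and> 0 \<le> Y \<omega> \<and> m \<le> sqrt (Y \<omega>) \<and>
            sqrt (Y \<omega>) \<le> (1 + \<delta>) * m \<and> sqrt (X \<omega>) + \<mu> \<le> q * sqrt (Y \<omega>)}
         \<le> exp (- ((1 - 8 * \<delta>) * \<mu>\<^sup>2 / V))"
    (is "measure M ?A \<le> _")
proof (cases "\<mu> \<le> q * ((1 + \<delta>) * m)")
  case False
  have "?A = {}"
  proof safe
    fix \<omega> assume \<omega>: "0 \<le> X \<omega>" "sqrt (Y \<omega>) \<le> (1 + \<delta>) * m" "sqrt (X \<omega>) + \<mu> \<le> q * sqrt (Y \<omega>)"
    have "q * sqrt (Y \<omega>) \<le> q * ((1 + \<delta>) * m)"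
      using \<omega> q by (intro mult_left_mono) auto
    moreover have "0 \<le> sqrt (X \<omega>)"
      using \<omega> by simp
    ultimately have False
      using False \<omega> by linarith
    then show "\<omega> \<in> {}" ..
  qed
  then show ?thesis by (simp only: measure_empty) simp
next
  case True
  interpret prob_space M by fact
  have [measurable]: "X \<in> borel_measurable M" "Y \<in> borel_measurable M"
    using bg by (auto simp: bivariate_gamma_def)
  have b: "0 \<le> b"
    using bg by (auto simp: bivariate_gamma_def)
  define w' where "w' = q * ((1 + \<delta>) * m) + \<delta> * \<mu>"
  define s where "s = \<mu> / (w' - \<mu>) / V"
  define \<rho> where "\<rho> = q\<^sup>2 * s / (1 + V * s)"
  have w': "(1 + \<delta>) * \<mu> \<le> w'"
    using True by (simp add: w'_def algebra_simps)
  have "0 < \<delta> * \<mu>"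
    using \<mu> \<delta> by simp
  then have w'\<mu>: "\<mu> < w'"
    using w' by (simp add: algebra_simps)
  have s: "0 \<le> s" and \<rho>: "0 \<le> \<rho>"
    using w'\<mu> \<mu> v by (auto simp: s_def \<rho>_def)
  have Vs: "1 + V * s = w' / (w' - \<mu>)"
    using w'\<mu> v by (simp add: s_def field_simps)
  have "\<rho> * (1 + v * s) \<le> \<rho> * (1 + V * s)"
    using \<rho> v s by (intro mult_left_mono add_mono mult_right_mono) auto
  also have "\<dots> = q\<^sup>2 * s"
    using Vs w'\<mu> \<mu> by (simp add: \<rho>_def)
  finally have \<rho>vs: "\<rho> * (1 + v * s) \<le> q\<^sup>2 * s" .
  define K where "K = 1 + (v + q\<^sup>2 * b) * s - (b + v * b * s) * \<rho>"
  have "1 \<le> K"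
  proof -
    have "b * (\<rho> * (1 + v * s)) \<le> b * (q\<^sup>2 * s)"
      using \<rho>vs b by (rule mult_left_mono)
    moreover have "0 \<le> v * s"
      using v s by simp
    ultimately show ?thesis
      by (simp add: K_def algebra_simps)
  qed
  have int: "(\<integral>\<^sup>+\<omega>. ennreal (exp (- s * X \<omega>) * exp (\<rho> * Y \<omega>)) \<partial>M) = ennreal (K powr - \<alpha>)"
    using bivariate_gamma_mixed[OF bg s \<rho>] \<open>1 \<le> K\<close> by (simp add: K_def)
  have "measure M ?A \<le> K powr - \<alpha> * exp (- ((1 - 8 * \<delta>) * \<mu>\<^sup>2 / V))"
  proof (rule exponential_Markov)
    fix \<omega> assume "\<omega> \<in> ?A"
    then have \<omega>: "0 \<le> X \<omega>" "0 \<le> Y \<omega>" "m \<le> sqrt (Y \<omega>)" "sqrt (Y \<omega>) \<le> (1 + \<delta>) * m"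
      "sqrt (X \<omega>) + \<mu> \<le> q * sqrt (Y \<omega>)" by auto
    define w where "w = q * sqrt (Y \<omega>)"
    have w: "q * m \<le> w" "w \<le> q * ((1 + \<delta>) * m)"
      unfolding w_def using \<omega> q by (auto intro: mult_left_mono)
    have "(w - w')\<^sup>2 \<le> 8 * \<delta> * (w' * (w' - \<mu>))"
    proof -
      have "w \<le> w'"
        using w \<open>0 < \<delta> * \<mu>\<close> by (simp add: w'_def)
      moreover have "w' - w \<le> 2 * \<delta> * w'"
      proof -
        have "w' - w \<le> \<delta> * (q * m) + \<delta> * \<mu>"
          using w by (simp add: w'_def algebra_simps)
        also have "\<dots> \<le> \<delta> * w' + \<delta> * w'"
          using w'\<mu> \<delta> \<open>w \<le> w'\<close> w by (intro add_mono mult_left_mono) auto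
        finally show ?thesis by simp
      qed
      ultimately have "(w' - w)\<^sup>2 \<le> (2 * \<delta> * w')\<^sup>2"
        by (intro power_mono) auto
      also have "\<dots> = 4 * \<delta> * w' * (\<delta> * w')"
        by (simp add: power2_eq_square)
      also have "\<dots> \<le> 4 * \<delta> * w' * (2 * (w' - \<mu>))"
      proof (rule mult_left_mono)
        have "\<delta> * w' \<le> (1 + \<delta>) * (w' - \<mu>)"
          using w' by (simp add: algebra_simps)
        also have "\<dots> \<le> 2 * (w' - \<mu>)"
          using \<delta> w'\<mu> by (intro mult_right_mono) auto
        finally show "\<delta> * w' \<le> 2 * (w' - \<mu>)" .
      qed (use \<delta> w'\<mu> \<mu> in auto)
      finally show ?thesis
        by (simp add: power2_commute mult_ac)
    qed
    moreover have "X \<omega> \<le> (w - \<mu>)\<^sup>2"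
    proof -
      have "(sqrt (X \<omega>))\<^sup>2 \<le> (w - \<mu>)\<^sup>2"
        using \<omega> by (intro power_mono) (auto simp: w_def)
      then show ?thesis using \<omega> by simp
    qed
    ultimately have "(1 - 8 * \<delta>) * \<mu>\<^sup>2 \<le> \<mu> / (w' - \<mu>) * (w\<^sup>2 * (w' - \<mu>) / w' - X \<omega>)"
      using w'\<mu> \<mu> by (intro lower_exponent) auto
    then have "(1 - 8 * \<delta>) * \<mu>\<^sup>2 / V \<le> \<mu> / (w' - \<mu>) * (w\<^sup>2 * (w' - \<mu>) / w' - X \<omega>) / V"
      using v by (intro divide_right_mono) auto
    also have "\<dots> = s * (w\<^sup>2 / (1 + V * s) - X \<omega>)"
      by (simp only: Vs) (simp add: s_def)
    also have "\<dots> = - s * X \<omega> + \<rho> * Y \<omega>"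
      using \<omega> by (simp add: w_def \<rho>_def power_mult_distrib algebra_simps)
    finally show "exp ((1 - 8 * \<delta>) * \<mu>\<^sup>2 / V) \<le> exp (- s * X \<omega>) * exp (\<rho> * Y \<omega>)"
      by (simp flip: exp_add)
  qed (use int in auto)
  also have "\<dots> \<le> 1 * exp (- ((1 - 8 * \<delta>) * \<mu>\<^sup>2 / V))"
    using \<open>1 \<le> K\<close> \<alpha> powr_mono2'[of "- \<alpha>" 1 K] by (intro mult_right_mono) auto
  finally show ?thesis by simp
qed

section \<open>Almost sure bound for the increments of the square root\<close>

text \<open>
  If \<open>u y y = 0\<close>, then \<open>u x y * u y x\<close> vanishes as well, and the formulas \<open>v = a - c / b\<close> and
  \<open>q = sqrt c / b\<close> still give suitable values, \<open>u x x\<close> and \<open>0\<close>, since \<open>c / 0 = 0\<close>.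
\<close>

lemma permanental_pair_parameters:
  assumes M: "prob_space M" and \<alpha>: "0 < \<alpha>" and perm: "permanental_process M \<alpha> T u X"
    and T: "x \<in> T" "y \<in> T"
  obtains v q where "0 \<le> v" "0 \<le> q"
    and "bivariate_gamma M \<alpha> (v + q\<^sup>2 * u y y) (u y y) (v * u y y) (X x) (X y)"
    and "(sigma_fun u x y)\<^sup>2 = v + u y y * (1 - q)\<^sup>2"
    and "0 \<le> sigma_fun u x y"
proof -
  define a where "a = u x x"
  define b where "b = u y y"
  define c where "c = u x y * u y x"
  have bg: "bivariate_gamma M \<alpha> a b (a * b - c) (X x) (X y)"
    unfolding a_def b_def c_def by (rule permanental_process_bivariate_gamma) fact+
  have nn: "0 \<le> a" "0 \<le> b" "c \<le> a * b"
    using bg by (auto simp: bivariate_gamma_def)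
  have c: "0 \<le> c"
    using bivariate_gamma_cross_le[OF bg \<alpha>] by simp
  define v where "v = a - c / b"
  define q where "q = sqrt c / b"
  have c0: "c = 0" if "b = 0"
    using that nn c by simp
  have v: "0 \<le> v"
    using nn c by (cases "b = 0") (auto simp: v_def field_simps)
  have q: "0 \<le> q"
    using nn c by (simp add: q_def)
  have qb: "q * b = sqrt c"
    using c0 by (cases "b = 0") (auto simp: q_def)
  have q2b: "q\<^sup>2 * b = c / b"
    using c by (cases "b = 0") (auto simp: q_def power2_eq_square)
  have a: "v + q\<^sup>2 * b = a"
    by (simp add: v_def q2b)
  have vb: "v * b = a * b - c"
    using c0 by (cases "b = 0") (auto simp: v_def field_simps)
  have "v + b * (1 - q)\<^sup>2 = (v + q\<^sup>2 * b) + b - 2 * (q * b)"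
    by (simp add: power2_eq_square algebra_simps)
  then have eq: "v + b * (1 - q)\<^sup>2 = a + b - 2 * sqrt c"
    by (simp add: a qb)
  have "0 \<le> v + b * (1 - q)\<^sup>2"
    using v nn by simp
  then have "(sigma_fun u x y)\<^sup>2 = v + b * (1 - q)\<^sup>2" "0 \<le> sigma_fun u x y"
    unfolding sigma_fun_def using eq by (auto simp: a_def b_def c_def)
  with v q bg show thesis
    unfolding b_def[symmetric] by (intro that[of v q]) (simp_all add: a vb b_def[symmetric])
qed

text \<open>
  The nonnegative function \<open>exp Z + exp (- Z) - 2\<close>, which vanishes only for \<open>Z = 0\<close>, has integral \<open>0\<close>.
\<close>

lemma (in prob_space) AE_eq_0_if_exp_moments_1:
  assumes [measurable]: "Z \<in> borel_measurable M"
    and 1: "(\<integral>\<^sup>+\<omega>. ennreal (exp (Z \<omega>)) \<partial>M) = 1" and 2: "(\<integral>\<^sup>+\<omega>. ennreal (exp (- Z \<omega>)) \<partial>M) = 1"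
  shows "AE \<omega> in M. Z \<omega> = 0"
proof -
  have "has_bochner_integral M (\<lambda>\<omega>. exp (Z \<omega>)) 1" "has_bochner_integral M (\<lambda>\<omega>. exp (- Z \<omega>)) 1"
    using 1 2 by (auto intro!: has_bochner_integral_nn_integral)
  moreover have "has_bochner_integral M (\<lambda>\<omega>. 2) (2 :: real)"
    using prob_space by (simp add: has_bochner_integral_iff)
  ultimately have *: "has_bochner_integral M (\<lambda>\<omega>. exp (Z \<omega>) + exp (- Z \<omega>) - 2) (1 + 1 - 2)"
    by (intro has_bochner_integral_add has_bochner_integral_diff)
  have sq: "exp z + exp (- z) - 2 = (exp z - 1)\<^sup>2 / exp z" for z :: real
    by (simp add: exp_minus power2_eq_square field_simps)
  have "AE \<omega> in M. exp (Z \<omega>) + exp (- Z \<omega>) - 2 = 0"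
    using * by (subst integral_nonneg_eq_0_iff_AE[symmetric]) (auto simp: has_bochner_integral_iff sq)
  then show ?thesis
    by eventually_elim (simp add: sq)
qed

lemma bivariate_gamma_degenerate:
  assumes "prob_space M" and bg: "bivariate_gamma M \<alpha> (q\<^sup>2 * b) b 0 X Y"
  shows "AE \<omega> in M. X \<omega> = q\<^sup>2 * Y \<omega>"
proof -
  interpret prob_space M by fact
  have [measurable]: "X \<in> borel_measurable M" "Y \<in> borel_measurable M"
    using bg by (auto simp: bivariate_gamma_def)
  have "AE \<omega> in M. X \<omega> - q\<^sup>2 * Y \<omega> = 0"
  proof (rule AE_eq_0_if_exp_moments_1)
    show "(\<integral>\<^sup>+\<omega>. ennreal (exp (X \<omega> - q\<^sup>2 * Y \<omega>)) \<partial>M) = 1"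
      using bivariate_gamma_mixed[OF bivariate_gamma_swap[OF bg], of "q\<^sup>2" 1]
      by (simp add: mult.commute flip: exp_add)
    show "(\<integral>\<^sup>+\<omega>. ennreal (exp (- (X \<omega> - q\<^sup>2 * Y \<omega>))) \<partial>M) = 1"
      using bivariate_gamma_mixed[OF bg, of 1 "q\<^sup>2"]
      by (simp add: mult.commute flip: exp_add)
  qed simp
  then show ?thesis by simp
qed

lemma bivariate_gamma_AE_0:
  assumes "prob_space M" and bg: "bivariate_gamma M \<alpha> a 0 D X Y"
  shows "AE \<omega> in M. Y \<omega> = 0"
proof -
  interpret prob_space M by fact
  have [measurable]: "Y \<in> borel_measurable M" and Y: "AE \<omega> in M. 0 \<le> Y \<omega>"
    using bg by (auto simp: bivariate_gamma_def)
  show ?thesis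
  proof (rule AE_eq_0_if_exp_moments_1)
    show "(\<integral>\<^sup>+\<omega>. ennreal (exp (Y \<omega>)) \<partial>M) = 1"
      using bivariate_gamma_mixed[OF bg, of 0 1] by simp
    show "(\<integral>\<^sup>+\<omega>. ennreal (exp (- Y \<omega>)) \<partial>M) = 1"
      using bg[unfolded bivariate_gamma_def, THEN conjunct2, THEN conjunct2, THEN conjunct2,
        THEN conjunct2, THEN conjunct2, THEN conjunct2, THEN conjunct2, rule_format, of 0 1] by simp
  qed simp
qed

lemma (in prob_space) borel_cantelli_powr:
  assumes [measurable]: "\<And>n. E n \<in> events" and p: "1 < p"
    and bound: "\<And>n. prob (E n) \<le> C * real n powr - p"
  shows "AE \<omega> in M. \<forall>\<^sub>F n in sequentially. \<omega> \<notin> E n"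
proof -
  have "summable (\<lambda>n. prob (E n))"
    by (rule summable_comparison_test_ev[where g = "\<lambda>n. C * real n powr - p"])
       (use p bound in \<open>auto intro!: summable_mult simp: summable_real_powr_iff\<close>)
  then have "AE \<omega> in M. \<forall>\<^sub>F n in sequentially. \<omega> \<in> space M - E n"
    by (intro borel_cantelli_AE1) (auto simp: emeasure_eq_measure)
  then show ?thesis
    by eventually_elim (auto elim: eventually_mono)
qed

text \<open>
  Borel-Cantelli on each of countably many events on which \<open>Y\<close> is nearly constant.  The \<open>n\<close> with
  \<open>\<sigma> n = 0\<close>, for which a Chernoff bound makes no sense, are treated by the almost sure equality
  \<open>Z n = Y\<close>.
\<close>

lemma permanental_sqrt_increments:
  fixes T :: "'i set" and x :: "nat \<Rightarrow> 'i"
  assumes M: "prob_space M" and \<alpha>: "0 < \<alpha>" and perm: "permanental_process M \<alpha> T u X"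
    and y: "y \<in> T" and x: "\<And>n. n \<ge> 1 \<Longrightarrow> x n \<in> T"
  shows "AE \<omega> in M. 0 \<le> X y \<omega> \<and> (\<forall>n\<ge>1. 0 \<le> X (x n) \<omega>) \<and>
    (\<forall>\<epsilon>>0. \<forall>\<^sub>F n in sequentially. \<bar>sqrt (X (x n) \<omega>) - sqrt (X y \<omega>)\<bar>
       \<le> (1 + \<epsilon>) * (sigma_fun u (x n) y * sqrt (ln (real n))))"
proof -
  interpret prob_space M by fact
  define b where "b = u y y"
  define Y where "Y = X y"
  define Z where "Z n = X (x n)" for n
  define \<sigma> where "\<sigma> n = sigma_fun u (x n) y" for n
  have "\<forall>n. \<exists>v q. n \<ge> 1 \<longrightarrow> 0 \<le> v \<and> 0 \<le> q \<and>
      bivariate_gamma M \<alpha> (v + q\<^sup>2 * b) b (v * b) (Z n) Y \<and> (\<sigma> n)\<^sup>2 = v + b * (1 - q)\<^sup>2 \<and> 0 \<le> \<sigma> n"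
    unfolding b_def Y_def Z_def \<sigma>_def using permanental_pair_parameters[OF M \<alpha> perm x y] by metis
  then obtain v q where *: "\<forall>n. n \<ge> 1 \<longrightarrow> 0 \<le> v n \<and> 0 \<le> q n \<and>
      bivariate_gamma M \<alpha> (v n + (q n)\<^sup>2 * b) b (v n * b) (Z n) Y \<and>
      (\<sigma> n)\<^sup>2 = v n + b * (1 - q n)\<^sup>2 \<and> 0 \<le> \<sigma> n"
    by metis
  then have v: "0 \<le> v n" and q: "0 \<le> q n"
    and bg: "bivariate_gamma M \<alpha> (v n + (q n)\<^sup>2 * b) b (v n * b) (Z n) Y"
    and \<sigma>: "(\<sigma> n)\<^sup>2 = v n + b * (1 - q n)\<^sup>2" "0 \<le> \<sigma> n" if "n \<ge> 1" for n
    using that by auto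
  have b: "0 \<le> b" and [measurable]: "Y \<in> borel_measurable M" and Y0: "AE \<omega> in M. 0 \<le> Y \<omega>"
    using bg[of 1] by (auto simp: bivariate_gamma_def)
  have Zmeas: "Z n \<in> borel_measurable M" and Z0: "AE \<omega> in M. 0 \<le> Z n \<omega>" if "n \<ge> 1" for n
    using bg[OF that] by (auto simp: bivariate_gamma_def)
  (* The loss factor 1 - 8 * \<delta> e in the exponent leaves the summable power n powr - (1 + e). *)
  define \<delta> where "\<delta> e = e / (8 * (1 + e))" for e :: real
  have \<delta>: "0 < \<delta> e" "\<delta> e \<le> 1" "(\<delta> e)\<^sup>2 \<le> 8 * \<delta> e" "(1 - 8 * \<delta> e) * (1 + e)\<^sup>2 = 1 + e" if "0 < e" for e
  proof -
    show "0 < \<delta> e" and le: "\<delta> e \<le> 1"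
      using that by (auto simp: \<delta>_def divide_simps)
    have "\<delta> e * \<delta> e \<le> \<delta> e * 1"
      using \<open>0 < \<delta> e\<close> le by (intro mult_left_mono) auto
    also have "\<dots> \<le> 8 * \<delta> e"
      using \<open>0 < \<delta> e\<close> by simp
    finally show "(\<delta> e)\<^sup>2 \<le> 8 * \<delta> e"
      by (simp add: power2_eq_square)
    have "1 - 8 * \<delta> e = 1 / (1 + e)"
      using that by (simp add: \<delta>_def field_simps)
    then show "(1 - 8 * \<delta> e) * (1 + e)\<^sup>2 = 1 + e"
      using that by (simp add: power2_eq_square)
  qed
  define \<mu> where "\<mu> e n = (1 + e) * (\<sigma> n * sqrt (ln (real n)))" for e n
  define E where "E e m n = (if n \<ge> 2 \<and> 0 < \<sigma> n then
      {\<omega> \<in> space M. 0 \<le> Z n \<omega> \<and> 0 \<le> Y \<omega> \<and> m \<le> sqrt (Y \<omega>) \<and> sqrt (Y \<omega>) \<le> (1 + \<delta> e) * m \<and>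
         q n * sqrt (Y \<omega>) + \<mu> e n \<le> sqrt (Z n \<omega>)} \<union>
      {\<omega> \<in> space M. 0 \<le> Z n \<omega> \<and> 0 \<le> Y \<omega> \<and> m \<le> sqrt (Y \<omega>) \<and> sqrt (Y \<omega>) \<le> (1 + \<delta> e) * m \<and>
         sqrt (Z n \<omega>) + \<mu> e n \<le> q n * sqrt (Y \<omega>)} else {})" for e m n
  have E_sets: "E e m n \<in> events" for e m n
    using Zmeas[of n] unfolding E_def by (auto simp del: real_sqrt_le_iff)
  have E_AE: "AE \<omega> in M. \<forall>\<^sub>F n in sequentially. \<omega> \<notin> E e m n" if e: "0 < e" and m: "0 \<le> m" for e m
  proof (rule borel_cantelli_powr[OF E_sets])
    show "1 < 1 + e"
      using e by simp
    define C where "C = ((\<delta> e)\<^sup>2 / (1 + (\<delta> e)\<^sup>2)) powr - \<alpha>"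
    show "prob (E e m n) \<le> (C + 1) * real n powr - (1 + e)" for n
    proof (cases "n \<ge> 2 \<and> 0 < \<sigma> n")
      case False
      then have "E e m n = {}"
        by (auto simp: E_def)
      then show ?thesis
        by (simp add: C_def)
    next
      case True
      then have n: "n \<ge> 1" "0 < ln (real n)" and \<sigma>n: "0 < \<sigma> n" by auto
      note [measurable] = Zmeas[OF n(1)]
      have v\<sigma>: "v n \<le> (\<sigma> n)\<^sup>2"
        using \<sigma>(1)[OF n(1)] b by simp
      have \<mu>: "0 < \<mu> e n"
        using e n \<sigma>n by (simp add: \<mu>_def)
      have sq: "(\<mu> e n)\<^sup>2 / (\<sigma> n)\<^sup>2 = (1 + e)\<^sup>2 * ln (real n)"
        using n \<sigma>n by (simp add: \<mu>_def power_mult_distrib)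
      have exp_le: "exp (- (d * (\<mu> e n)\<^sup>2 / (\<sigma> n)\<^sup>2)) \<le> real n powr - (1 + e)"
        if "1 - 8 * \<delta> e \<le> d" for d
      proof -
        have "(1 + e) * ln (real n) = (1 - 8 * \<delta> e) * ((1 + e)\<^sup>2 * ln (real n))"
          unfolding mult.assoc[symmetric] \<delta>(4)[OF e] ..
        also have "\<dots> \<le> d * ((1 + e)\<^sup>2 * ln (real n))"
          using that n by (intro mult_right_mono) auto
        also have "\<dots> = d * (\<mu> e n)\<^sup>2 / (\<sigma> n)\<^sup>2"
          by (simp add: sq flip: times_divide_eq_right)
        finally have "exp (- (d * (\<mu> e n)\<^sup>2 / (\<sigma> n)\<^sup>2)) \<le> exp (- ((1 + e) * ln (real n)))"
          by simp
        also have "\<dots> = real n powr - (1 + e)"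
          using n by (simp only: powr_def mult_minus_left) simp
        finally show ?thesis .
      qed
      let ?A = "{\<omega> \<in> space M. 0 \<le> Z n \<omega> \<and> 0 \<le> Y \<omega> \<and> m \<le> sqrt (Y \<omega>) \<and> sqrt (Y \<omega>) \<le> (1 + \<delta> e) * m \<and>
         q n * sqrt (Y \<omega>) + \<mu> e n \<le> sqrt (Z n \<omega>)}"
      let ?B = "{\<omega> \<in> space M. 0 \<le> Z n \<omega> \<and> 0 \<le> Y \<omega> \<and> m \<le> sqrt (Y \<omega>) \<and> sqrt (Y \<omega>) \<le> (1 + \<delta> e) * m \<and>
         sqrt (Z n \<omega>) + \<mu> e n \<le> q n * sqrt (Y \<omega>)}"
      have "prob ?A \<le> C * exp (- ((1 - (\<delta> e)\<^sup>2) * (\<mu> e n)\<^sup>2 / (\<sigma> n)\<^sup>2))"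
        unfolding C_def
        by (rule bivariate_gamma_upper_tail[OF M bg[OF n(1)] \<alpha> q[OF n(1)] v[OF n(1)] v\<sigma>])
           (use \<sigma>n \<mu> \<delta>[OF e] m in auto)
      also have "\<dots> \<le> C * real n powr - (1 + e)"
        using \<delta>(3)[OF e] by (intro mult_left_mono exp_le) (auto simp: C_def)
      finally have A: "prob ?A \<le> C * real n powr - (1 + e)" .
      have "prob ?B \<le> exp (- ((1 - 8 * \<delta> e) * (\<mu> e n)\<^sup>2 / (\<sigma> n)\<^sup>2))"
        by (rule bivariate_gamma_lower_tail[OF M bg[OF n(1)] \<alpha> q[OF n(1)] v[OF n(1)] v\<sigma>])
           (use \<sigma>n \<mu> \<delta>[OF e] m in auto)
      also have "\<dots> \<le> real n powr - (1 + e)"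
        by (rule exp_le) simp
      finally have B: "prob ?B \<le> real n powr - (1 + e)" .
      have E_Un: "E e m n = ?A \<union> ?B"
        unfolding E_def by (rule if_P[OF True])
      have "prob (?A \<union> ?B) \<le> prob ?A + prob ?B"
        by (rule measure_Un_le) measurable
      then have "prob (E e m n) \<le> C * real n powr - (1 + e) + real n powr - (1 + e)"
        unfolding E_Un using A B by linarith
      then show ?thesis
        by (simp only: distrib_right mult_1)
    qed
  qed
  have "AE \<omega> in M. \<forall>m\<in>{m \<in> \<rat>. 0 \<le> m}. \<forall>\<^sub>F n in sequentially. \<omega> \<notin> E (1 / real (Suc k)) m n" for k
  proof (subst AE_ball_countable)
    show "countable {m \<in> \<rat>. 0 \<le> (m :: real)}"
      by (rule countable_subset[OF _ countable_rat]) auto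
  qed (simp add: E_AE)
  then have "AE \<omega> in M. \<forall>k. \<forall>m\<in>{m \<in> \<rat>. 0 \<le> m}. \<forall>\<^sub>F n in sequentially. \<omega> \<notin> E (1 / real (Suc k)) m n"
    by (subst AE_all_countable) blast
  moreover have "AE \<omega> in M. \<forall>n. n \<ge> 1 \<longrightarrow> 0 \<le> Z n \<omega>"
  proof (subst AE_all_countable, rule allI)
    show "AE \<omega> in M. n \<ge> 1 \<longrightarrow> 0 \<le> Z n \<omega>" for n
      using Z0[of n] by (cases "n \<ge> 1") simp_all
  qed
  moreover have "AE \<omega> in M. b = 0 \<longrightarrow> Y \<omega> = 0"
  proof (cases "b = 0")
    case True
    then have "AE \<omega> in M. Y \<omega> = 0"
      using bg[of 1] by (intro bivariate_gamma_AE_0[OF M, of \<alpha> "v 1" 0 "Z 1" Y]) simp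
    then show ?thesis by eventually_elim simp
  qed simp
  moreover have "AE \<omega> in M. \<forall>n. n \<ge> 1 \<and> v n = 0 \<longrightarrow> Z n \<omega> = (q n)\<^sup>2 * Y \<omega>"
  proof (subst AE_all_countable, rule allI)
    fix n
    show "AE \<omega> in M. n \<ge> 1 \<and> v n = 0 \<longrightarrow> Z n \<omega> = (q n)\<^sup>2 * Y \<omega>"
    proof (cases "n \<ge> 1 \<and> v n = 0")
      case True
      then have "bivariate_gamma M \<alpha> ((q n)\<^sup>2 * b) b 0 (Z n) Y"
        using bg[of n] by simp
      from bivariate_gamma_degenerate[OF M this] show ?thesis
        by eventually_elim simp
    next
      case False
      then show ?thesis
        by (intro AE_I2) auto
    qed
  qed
  ultimately show ?thesis
    using Y0 AE_space unfolding Y_def[symmetric] Z_def[symmetric] \<sigma>_def[symmetric]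
  proof eventually_elim
    case (elim \<omega>)
    have "\<forall>\<^sub>F n in sequentially. \<bar>sqrt (Z n \<omega>) - sqrt (Y \<omega>)\<bar> \<le> (1 + \<epsilon>) * (\<sigma> n * sqrt (ln (real n)))"
      if \<epsilon>: "0 < \<epsilon>" for \<epsilon>
    proof -
      obtain k where k: "1 / real (Suc k) < \<epsilon> / 2"
        using nat_approx_posE[of "\<epsilon> / 2"] \<epsilon> by auto
      define e where "e = 1 / real (Suc k)"
      have e: "0 < e" "2 * e \<le> \<epsilon>"
        using k by (auto simp: e_def)
      obtain m where m: "m \<in> \<rat>" "0 \<le> m" "m \<le> sqrt (Y \<omega>)" "sqrt (Y \<omega>) \<le> (1 + \<delta> e) * m"
      proof (cases "Y \<omega> = 0")
        case True
        then show ?thesis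
          by (intro that[of 0]) auto
      next
        case False
        then have s: "0 < sqrt (Y \<omega>)"
          using elim by simp
        have "sqrt (Y \<omega>) / (1 + \<delta> e) < sqrt (Y \<omega>)"
          using s \<delta>(1)[OF e(1)] by (simp add: divide_less_eq)
        then obtain m where m: "m \<in> \<rat>" "sqrt (Y \<omega>) / (1 + \<delta> e) < m" "m < sqrt (Y \<omega>)"
          using Rats_dense_in_real by blast
        have "0 < sqrt (Y \<omega>) / (1 + \<delta> e)"
          using s \<delta>(1)[OF e(1)] by simp
        then have "0 \<le> m"
          using m(2) by linarith
        moreover have "sqrt (Y \<omega>) \<le> (1 + \<delta> e) * m"
          using m(2) \<delta>(1)[OF e(1)] by (simp add: divide_less_eq mult.commute)
        ultimately show ?thesis
          using m by (intro that[of m]) auto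
      qed
      have "\<forall>\<^sub>F n in sequentially. \<omega> \<notin> E e m n"
        using elim m unfolding e_def by blast
      moreover have "\<forall>\<^sub>F n in sequentially. sqrt (Y \<omega> / b) / e \<le> sqrt (ln (real n))"
      proof -
        have "filterlim (\<lambda>n. sqrt (ln (real n))) at_top sequentially"
          by (intro filterlim_compose[OF sqrt_at_top] filterlim_compose[OF ln_at_top]
                filterlim_real_sequentially)
        then show ?thesis
          by (simp add: filterlim_at_top)
      qed
      ultimately show ?thesis
        using eventually_ge_at_top[of 2]
      proof eventually_elim
        case (elim n)
        then have n: "n \<ge> 1" "0 < ln (real n)" by auto
        note ZY = \<open>\<forall>n. 1 \<le> n \<longrightarrow> 0 \<le> Z n \<omega>\<close>[rule_format, OF n(1)] \<open>0 \<le> Y \<omega>\<close>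
        show ?case
        proof (cases "\<sigma> n = 0")
          case True
          then have "v n = 0" "b * (1 - q n)\<^sup>2 = 0"
            using \<sigma>(1)[OF n(1)] v[OF n(1)] b
            by (auto simp: add_nonneg_eq_0_iff)
          then have "Z n \<omega> = (q n)\<^sup>2 * Y \<omega>" "q n = 1 \<or> Y \<omega> = 0"
            using n \<open>b = 0 \<longrightarrow> Y \<omega> = 0\<close>
              \<open>\<forall>n. 1 \<le> n \<and> v n = 0 \<longrightarrow> Z n \<omega> = (q n)\<^sup>2 * Y \<omega>\<close> by auto
          then show ?thesis
            using True by auto
        next
          case False
          then have \<sigma>n: "0 < \<sigma> n"
            using \<sigma>(2)[OF n(1)] by simp
          have "\<bar>sqrt (Z n \<omega>) - q n * sqrt (Y \<omega>)\<bar> \<le> \<mu> e n"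
          proof (rule ccontr)
            assume "\<not> ?thesis"
            then have "\<omega> \<in> E e m n"
              using ZY m \<sigma>n elim \<open>\<omega> \<in> space M\<close> by (auto simp: E_def)
            then show False using elim by simp
          qed
          moreover have "\<bar>1 - q n\<bar> * sqrt (Y \<omega>) \<le> \<sigma> n * sqrt (Y \<omega> / b)"
          proof (cases "b = 0")
            case True
            then show ?thesis
              using \<open>b = 0 \<longrightarrow> Y \<omega> = 0\<close> by simp
          next
            case False
            have "(sqrt b * \<bar>1 - q n\<bar>)\<^sup>2 \<le> (\<sigma> n)\<^sup>2"
              using \<sigma>(1)[OF n(1)] v[OF n(1)] b by (simp add: power_mult_distrib)
            then have "sqrt b * \<bar>1 - q n\<bar> \<le> \<sigma> n"
              by (rule power2_le_imp_le) (use \<sigma>n in simp)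
            then have "sqrt b * \<bar>1 - q n\<bar> * sqrt (Y \<omega> / b) \<le> \<sigma> n * sqrt (Y \<omega> / b)"
              using ZY b by (intro mult_right_mono) auto
            moreover have "sqrt (Y \<omega>) = sqrt b * sqrt (Y \<omega> / b)"
              using False b by (simp flip: real_sqrt_mult)
            ultimately show ?thesis
              by (simp add: mult_ac)
          qed
          moreover have "\<sigma> n * sqrt (Y \<omega> / b) \<le> e * (\<sigma> n * sqrt (ln (real n)))"
            using elim e \<sigma>n by (simp add: divide_le_eq mult_ac)
          moreover have "\<bar>sqrt (Z n \<omega>) - sqrt (Y \<omega>)\<bar>
              \<le> \<bar>sqrt (Z n \<omega>) - q n * sqrt (Y \<omega>)\<bar> + \<bar>1 - q n\<bar> * sqrt (Y \<omega>)"
          proof -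
            have "sqrt (Z n \<omega>) - sqrt (Y \<omega>) =
                (sqrt (Z n \<omega>) - q n * sqrt (Y \<omega>)) - (1 - q n) * sqrt (Y \<omega>)"
              by (simp add: algebra_simps)
            also have "\<bar>\<dots>\<bar> \<le> \<bar>sqrt (Z n \<omega>) - q n * sqrt (Y \<omega>)\<bar> + \<bar>(1 - q n) * sqrt (Y \<omega>)\<bar>"
              by (rule abs_triangle_ineq4)
            finally show ?thesis
              using ZY by (simp add: abs_mult)
          qed
          ultimately have "\<bar>sqrt (Z n \<omega>) - sqrt (Y \<omega>)\<bar> \<le> (1 + 2 * e) * (\<sigma> n * sqrt (ln (real n)))"
            by (simp add: \<mu>_def algebra_simps)
          also have "\<dots> \<le> (1 + \<epsilon>) * (\<sigma> n * sqrt (ln (real n)))"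
            using e n \<sigma>n by (intro mult_right_mono) auto
          finally show ?thesis .
        qed
      qed
    qed
    then show ?case
      using elim by blast
  qed
qed

section \<open>Upper limits of the process\<close>

lemma abs_diff_le_of_sqrt:
  fixes x y e :: real
  assumes "0 \<le> x" "0 \<le> y" and e: "\<bar>sqrt x - sqrt y\<bar> \<le> e"
  shows "\<bar>x - y\<bar> \<le> e * (2 * sqrt y + e)"
proof -
  have "\<bar>x - y\<bar> = \<bar>(sqrt x - sqrt y) * (sqrt x + sqrt y)\<bar>"
    using assms(1,2) by (simp add: algebra_simps)
  also have "\<dots> = \<bar>sqrt x - sqrt y\<bar> * (sqrt x + sqrt y)"
    using assms(1,2) by (simp add: abs_mult)
  also have "\<dots> \<le> e * (2 * sqrt y + e)"
    using assms by (intro mult_mono) auto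
  finally show ?thesis .
qed

text \<open>
  What remains is deterministic: a sequence whose square roots satisfy the bound above along one
  path.  That bound also makes \<open>d\<close> eventually nonnegative.
\<close>

context
  fixes x d :: "nat \<Rightarrow> real" and y :: real
  assumes y: "0 \<le> y" and x: "\<And>n. n \<ge> 1 \<Longrightarrow> 0 \<le> x n"
    and close: "\<And>\<epsilon>. 0 < \<epsilon> \<Longrightarrow> \<forall>\<^sub>F n in sequentially. \<bar>sqrt (x n) - sqrt y\<bar> \<le> (1 + \<epsilon>) * d n"
begin

lemma eventually_scale_nonneg: "\<forall>\<^sub>F n in sequentially. 0 \<le> d n \<and> 0 \<le> x n"
proof -
  have "\<forall>\<^sub>F n in sequentially. \<bar>sqrt (x n) - sqrt y\<bar> \<le> (1 + 1) * d n"
    by (rule close) simp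
  then show ?thesis
    using eventually_ge_at_top[of 1]
  proof eventually_elim
    case (elim n)
    then show ?case
      using x[of n] by simp
  qed
qed

lemma limsup_ratio_le_1:
  assumes "(\<lambda>n. ereal ((d n)\<^sup>2)) \<longlonglongrightarrow> \<infinity>"
  shows "limsup (\<lambda>n. ereal (x n) / ereal ((d n)\<^sup>2)) \<le> 1"
proof (rule ereal_le_epsilon2)
  fix e :: real assume e: "0 < e"
  define \<epsilon> where "\<epsilon> = min 1 (e / 8)"
  have \<epsilon>: "0 < \<epsilon>" "\<epsilon> \<le> 1" "8 * \<epsilon> \<le> e"
    using e by (auto simp: \<epsilon>_def)
  have "\<epsilon> * \<epsilon> \<le> \<epsilon> * 1"
    using \<epsilon> by (intro mult_left_mono) auto
  moreover have "(1 + 2 * \<epsilon>)\<^sup>2 = 1 + 4 * \<epsilon> + 4 * (\<epsilon> * \<epsilon>)"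
    by (simp add: power2_eq_square algebra_simps)
  ultimately have \<epsilon>_sq: "(1 + 2 * \<epsilon>)\<^sup>2 \<le> 1 + e"
    using \<epsilon> by linarith
  have "\<forall>\<^sub>F n in sequentially. ereal ((sqrt y / \<epsilon>)\<^sup>2) < ereal ((d n)\<^sup>2)"
    using assms unfolding tendsto_PInfty by blast
  with eventually_scale_nonneg close[OF \<epsilon>(1)]
  have "\<forall>\<^sub>F n in sequentially. ereal (x n) / ereal ((d n)\<^sup>2) \<le> ereal (1 + e)"
  proof eventually_elim
    case (elim n)
    then have d: "sqrt y / \<epsilon> < d n"
      by (auto intro: power2_less_imp_less)
    then have d0: "0 < d n"
      using y \<epsilon> by (meson divide_nonneg_pos le_less_trans real_sqrt_ge_zero)
    have "sqrt y \<le> \<epsilon> * d n"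
      using d \<epsilon> by (simp add: divide_less_eq mult.commute)
    then have "sqrt (x n) \<le> (1 + 2 * \<epsilon>) * d n"
      using elim by (simp add: algebra_simps)
    then have "(sqrt (x n))\<^sup>2 \<le> ((1 + 2 * \<epsilon>) * d n)\<^sup>2"
      using elim by (intro power_mono) auto
    also have "\<dots> \<le> (1 + e) * (d n)\<^sup>2"
      unfolding power_mult_distrib using \<epsilon>_sq by (intro mult_right_mono) auto
    finally show ?case
      using elim d0 by (simp add: divide_le_eq)
  qed
  then have "limsup (\<lambda>n. ereal (x n) / ereal ((d n)\<^sup>2)) \<le> ereal (1 + e)"
    by (rule Limsup_bounded)
  then show "limsup (\<lambda>n. ereal (x n) / ereal ((d n)\<^sup>2)) \<le> 1 + ereal e"
    by (simp add: one_ereal_def)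
qed

lemma scale_tendsto:
  assumes "(\<lambda>n. (d n)\<^sup>2) \<longlonglongrightarrow> B\<^sup>2" "0 \<le> B"
  shows "d \<longlonglongrightarrow> B"
proof -
  have "(\<lambda>n. sqrt ((d n)\<^sup>2)) \<longlonglongrightarrow> B"
    using tendsto_real_sqrt[OF assms(1)] assms(2) by simp
  then show ?thesis
    by (rule Lim_transform_eventually)
       (use assms(2) eventually_scale_nonneg in \<open>auto elim: eventually_mono\<close>)
qed

lemma limsup_abs_diff_le:
  assumes B: "(\<lambda>n. (d n)\<^sup>2) \<longlonglongrightarrow> B\<^sup>2" "0 \<le> B"
  shows "limsup (\<lambda>n. ereal \<bar>x n - y\<bar>) \<le> ereal (B\<^sup>2 + 2 * B * sqrt y)"
proof (rule ereal_le_epsilon2)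
  fix e :: real assume e: "0 < e"
  have "((\<lambda>\<eta>. (1 + \<eta>) * (B + \<eta>) * (2 * sqrt y + (1 + \<eta>) * (B + \<eta>))) \<longlongrightarrow>
      (1 + 0) * (B + 0) * (2 * sqrt y + (1 + 0) * (B + 0))) (at_right 0)"
    by (intro tendsto_intros)
  then have "\<forall>\<^sub>F \<eta> in at_right 0. (1 + \<eta>) * (B + \<eta>) * (2 * sqrt y + (1 + \<eta>) * (B + \<eta>))
      < B\<^sup>2 + 2 * B * sqrt y + e"
    by (rule order_tendstoD) (use e in \<open>simp add: power2_eq_square algebra_simps\<close>)
  then have "\<exists>\<eta>>0. (1 + \<eta>) * (B + \<eta>) * (2 * sqrt y + (1 + \<eta>) * (B + \<eta>)) < B\<^sup>2 + 2 * B * sqrt y + e"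
    using eventually_at_right_less[of 0]
    by (metis (mono_tags, lifting) eventually_conj eventually_happens trivial_limit_at_right_real)
  then obtain \<eta> where \<eta>: "0 < \<eta>"
    "(1 + \<eta>) * (B + \<eta>) * (2 * sqrt y + (1 + \<eta>) * (B + \<eta>)) < B\<^sup>2 + 2 * B * sqrt y + e"
    by blast
  have "\<forall>\<^sub>F n in sequentially. d n < B + \<eta>"
    using scale_tendsto[OF B] \<eta> by (intro order_tendstoD) auto
  with eventually_scale_nonneg close[OF \<eta>(1)]
  have "\<forall>\<^sub>F n in sequentially. ereal \<bar>x n - y\<bar> \<le> ereal (B\<^sup>2 + 2 * B * sqrt y + e)"
  proof eventually_elim
    case (elim n)
    have "(1 + \<eta>) * d n \<le> (1 + \<eta>) * (B + \<eta>)"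
      using elim \<eta> by (intro mult_left_mono) auto
    with elim have "\<bar>sqrt (x n) - sqrt y\<bar> \<le> (1 + \<eta>) * (B + \<eta>)"
      by linarith
    then have "\<bar>x n - y\<bar> \<le> (1 + \<eta>) * (B + \<eta>) * (2 * sqrt y + (1 + \<eta>) * (B + \<eta>))"
      using elim y by (intro abs_diff_le_of_sqrt) auto
    then show ?case using \<eta> by simp
  qed
  then have "limsup (\<lambda>n. ereal \<bar>x n - y\<bar>) \<le> ereal (B\<^sup>2 + 2 * B * sqrt y + e)"
    by (rule Limsup_bounded)
  then show "limsup (\<lambda>n. ereal \<bar>x n - y\<bar>) \<le> ereal (B\<^sup>2 + 2 * B * sqrt y) + ereal e"
    by simp
qed

text \<open>
  Where \<open>d n = 0\<close>, the bound on the square roots gives \<open>x n = y\<close>, and the quotient is \<open>0 / 0 = 0\<close>.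
\<close>

lemma limsup_abs_diff_ratio_le:
  assumes B: "(\<lambda>n. (d n)\<^sup>2) \<longlonglongrightarrow> 0"
  shows "limsup (\<lambda>n. ereal \<bar>x n - y\<bar> / ereal (d n)) \<le> ereal (2 * sqrt y)"
proof (rule ereal_le_epsilon2)
  fix e :: real assume e: "0 < e"
  have "((\<lambda>\<eta>. (1 + \<eta>) * (2 * sqrt y + (1 + \<eta>) * \<eta>)) \<longlongrightarrow>
      (1 + 0) * (2 * sqrt y + (1 + 0) * 0)) (at_right 0)"
    by (intro tendsto_intros)
  then have "\<forall>\<^sub>F \<eta> in at_right 0. (1 + \<eta>) * (2 * sqrt y + (1 + \<eta>) * \<eta>) < 2 * sqrt y + e"
    by (rule order_tendstoD) (use e in simp)
  then have "\<exists>\<eta>>0. (1 + \<eta>) * (2 * sqrt y + (1 + \<eta>) * \<eta>) < 2 * sqrt y + e"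
    using eventually_at_right_less[of 0]
    by (metis (mono_tags, lifting) eventually_conj eventually_happens trivial_limit_at_right_real)
  then obtain \<eta> where \<eta>: "0 < \<eta>" "(1 + \<eta>) * (2 * sqrt y + (1 + \<eta>) * \<eta>) < 2 * sqrt y + e"
    by blast
  have "\<forall>\<^sub>F n in sequentially. d n < \<eta>"
    using scale_tendsto[of 0] B \<eta> by (intro order_tendstoD) auto
  with eventually_scale_nonneg close[OF \<eta>(1)]
  have "\<forall>\<^sub>F n in sequentially. ereal \<bar>x n - y\<bar> / ereal (d n) \<le> ereal (2 * sqrt y + e)"
  proof eventually_elim
    case (elim n)
    have "\<bar>x n - y\<bar> \<le> (1 + \<eta>) * d n * (2 * sqrt y + (1 + \<eta>) * d n)"
      using elim y by (intro abs_diff_le_of_sqrt) auto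
    also have "\<dots> \<le> (1 + \<eta>) * d n * (2 * sqrt y + (1 + \<eta>) * \<eta>)"
      using elim \<eta> by (intro mult_left_mono add_left_mono) auto
    also have "\<dots> = d n * ((1 + \<eta>) * (2 * sqrt y + (1 + \<eta>) * \<eta>))"
      by (simp add: mult_ac)
    also have "\<dots> \<le> d n * (2 * sqrt y + e)"
      using elim \<eta> by (intro mult_left_mono) auto
    finally have le: "\<bar>x n - y\<bar> \<le> d n * (2 * sqrt y + e)" .
    show ?case
    proof (cases "d n = 0")
      case True
      then have "x n = y"
        using le by simp
      then show ?thesis
        using True y e by (simp add: divide_ereal_def)
    next
      case False
      then show ?thesis
        using le elim by (simp add: divide_le_eq mult.commute)
    qed
  qed
  then have "limsup (\<lambda>n. ereal \<bar>x n - y\<bar> / ereal (d n)) \<le> ereal (2 * sqrt y + e)"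
    by (rule Limsup_bounded)
  then show "limsup (\<lambda>n. ereal \<bar>x n - y\<bar> / ereal (d n)) \<le> ereal (2 * sqrt y) + ereal e"
    by simp
qed

end

theorem theorem1p6:
  fixes M :: "'w measure"
    and \<alpha> :: real
    and t :: "nat \<Rightarrow> real"
    and u :: "real \<Rightarrow> real \<Rightarrow> real"
    and X :: "real \<Rightarrow> 'w \<Rightarrow> real"
    and \<beta> :: ereal
  assumes "prob_space M"
    and "\<alpha> > 0"
    and "\<And>n. n \<ge> 1 \<Longrightarrow> t n \<ge> 0"
    and "permanental_process M \<alpha> ({0} \<union> {t n | n. n \<ge> 1}) u X"
    and "\<beta> \<ge> 0"
    and "(\<lambda>n. ereal ((sigma_fun u (t n) 0)\<^sup>2 * ln (real n))) \<longlonglongrightarrow> \<beta>\<^sup>2"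
  shows "(\<beta> = \<infinity> \<longrightarrow>
            (AE \<omega> in M. limsup (\<lambda>n. ereal (X (t n) \<omega>) / ereal ((sigma_fun u (t n) 0)\<^sup>2 * ln (real n))) \<le> 1))
       \<and> (0 < \<beta> \<and> \<beta> < \<infinity> \<longrightarrow>
            (AE \<omega> in M. limsup (\<lambda>n. ereal \<bar>X (t n) \<omega> - X 0 \<omega>\<bar>)
                          \<le> \<beta>\<^sup>2 + 2 * \<beta> * ereal (sqrt (X 0 \<omega>))))
       \<and> (\<beta> = 0 \<longrightarrow>
            (AE \<omega> in M. limsup (\<lambda>n. ereal \<bar>X (t n) \<omega> - X 0 \<omega>\<bar>
                                      / ereal (sigma_fun u (t n) 0 * sqrt (ln (real n))))
                          \<le> ereal (2 * sqrt (X 0 \<omega>))))"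
proof -
  define d where "d n = sigma_fun u (t n) 0 * sqrt (ln (real n))" for n
  have d2: "(sigma_fun u (t n) 0)\<^sup>2 * ln (real n) = (d n)\<^sup>2" for n
    by (cases "n = 0") (simp_all add: d_def power_mult_distrib)
  have lim: "(\<lambda>n. ereal ((d n)\<^sup>2)) \<longlonglongrightarrow> \<beta>\<^sup>2"
    using assms(6) unfolding d2 .
  have main: "AE \<omega> in M. 0 \<le> X 0 \<omega> \<and> (\<forall>n\<ge>1. 0 \<le> X (t n) \<omega>) \<and>
    (\<forall>\<epsilon>>0. \<forall>\<^sub>F n in sequentially. \<bar>sqrt (X (t n) \<omega>) - sqrt (X 0 \<omega>)\<bar> \<le> (1 + \<epsilon>) * d n)"
    unfolding d_def
    by (rule permanental_sqrt_increments[OF assms(1,2,4), where y = 0]) auto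
  show ?thesis
    unfolding d2 d_def[symmetric]
  proof (intro conjI impI)
    assume "\<beta> = \<infinity>"
    then have lim': "(\<lambda>n. ereal ((d n)\<^sup>2)) \<longlonglongrightarrow> \<infinity>"
      using lim by (simp add: power2_eq_square)
    show "AE \<omega> in M. limsup (\<lambda>n. ereal (X (t n) \<omega>) / ereal ((d n)\<^sup>2)) \<le> 1"
      using main
    proof eventually_elim
      case (elim \<omega>)
      show ?case
        by (rule limsup_ratio_le_1[where y = "X 0 \<omega>", OF _ _ _ lim']) (use elim in auto)
    qed
  next
    assume "0 < \<beta> \<and> \<beta> < \<infinity>"
    then obtain B where B: "\<beta> = ereal B" "0 \<le> B"
      by (cases \<beta>) auto
    have lim': "(\<lambda>n. (d n)\<^sup>2) \<longlonglongrightarrow> B\<^sup>2"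
      using lim by (simp add: B power2_eq_square)
    show "AE \<omega> in M. limsup (\<lambda>n. ereal \<bar>X (t n) \<omega> - X 0 \<omega>\<bar>)
        \<le> \<beta>\<^sup>2 + 2 * \<beta> * ereal (sqrt (X 0 \<omega>))"
      using main
    proof eventually_elim
      case (elim \<omega>)
      have "limsup (\<lambda>n. ereal \<bar>X (t n) \<omega> - X 0 \<omega>\<bar>) \<le> ereal (B\<^sup>2 + 2 * B * sqrt (X 0 \<omega>))"
        by (rule limsup_abs_diff_le[OF _ _ _ lim' B(2)]) (use elim in auto)
      then show ?case
        by (simp add: B power2_eq_square flip: times_ereal.simps(1) plus_ereal.simps(1))
    qed
  next
    assume "\<beta> = 0"
    then have lim': "(\<lambda>n. (d n)\<^sup>2) \<longlonglongrightarrow> 0"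
      using lim by (simp add: power2_eq_square zero_ereal_def)
    show "AE \<omega> in M. limsup (\<lambda>n. ereal \<bar>X (t n) \<omega> - X 0 \<omega>\<bar> / ereal (d n)) \<le> ereal (2 * sqrt (X 0 \<omega>))"
      using main
    proof eventually_elim
      case (elim \<omega>)
      show ?case
        by (rule limsup_abs_diff_ratio_le[OF _ _ _ lim']) (use elim in auto)
    qed
  qed
qed

end
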